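(* Consider the system $\dot R=R\hat\Omega$, $\mathbb I\dot\Omega=(\mathbb I\Omega)\times\Omega+\tau$ with the control $$\tau=\begin{cases}-(\mathbb I\Omega)\times\Omega+\mathbb I(-k_Re_R-k_\Omega e_\Omega+\Omega\times\Omega_d+\dot\Omega_d)&\text{when }V_0(R(0),\Omega(0),0)\le2ak_R,\\-(\mathbb I\Omega)\times\Omega+\mathbb I(-k_R\tilde e_R-k_\Omega\tilde e_\Omega+\Omega\times\tilde\Omega_d+\dot{\tilde\Omega}_d)&\text{when }V_0(R(0),\Omega(0),0)>2ak_R,\end{cases}$$ where $k_R,k_\Omega,a,\mu,\epsilon,\theta_{b_0},\gamma$ are positive constants such that $0<a<1$, $0<\epsilon<1$, $0<\mu<\frac{4(1-a)k_Rk_\Omega}{4(1-a)k_R+k_\Omega^2}$, and, for the initial attitude angle $\theta_0>0$, $\theta_{b_0}\in(0,\theta_0)$, $1-\cos(\theta_0-\theta_{b_0})\le2\epsilon a$, $\gamma<\frac4{\theta_{b_0}}\sqrt{ak_R(1-\epsilon)}$. Define $$\mathcal R=\Big\{(R(0),\Omega(0))\in \mathrm{SO}(3)\times\mathbb R^3\ \Big|\ \|e_\Omega(0)\|<\max\big\{\sqrt{2k_R(2a-1+\cos\theta_0)},\ 2\sqrt{ak_R(1-\epsilon)}-\tfrac\gamma2\theta_{b_0}\big\}\Big\}.$$ Then the region of attraction guaranteeing exponential convergence contains $\mathcal R$: for every initial state $(R(0),\Omega(0))\in\mathcal R$, the tracking errors $\|E_R(t)\|$ and $\|e_\Omega(t)\|$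 converge to zero exponentially as $t\to\infty$. Furthermore, $\mathcal R$ covers $\mathrm{SO}(3)$ completely, i.e., for every $R(0)\in \mathrm{SO}(3)$ there is $\Omega(0)\in\mathbb R^3$ with $(R(0),\Omega(0))\in\mathcal R$; and $\mathcal R$ is enlarged to all of $\mathbb R^3$ in the angular velocity in the semi-global sense as $k_R$ is increased, i.e., for each $R(0)$, with the other parameters fixed, the upper bound on $\|e_\Omega(0)\|$ in the definition of $\mathcal R$ tends to infinity as $k_R\to\infty$.
   Context: $\|A\|^2=\operatorname{tr}(A^TA)$ for a matrix or vector $A$. The hat map is defined by $\hat v w=v\times w$ for $v,w\in\mathbb R^3$; $\vee$ is its inverse on skew-symmetric matrices. $e_3=(0,0,1)$, $Z_\theta=\exp(\theta\hat e_3)$. $\mathbb I\in\mathbb R^{3\times3}$ is a symmetric positive-definite (inertia) matrix, $R\in \mathrm{SO}(3)$ the attitude, $\Omega\in\mathbb R^3$ the angular velocity. $(R_d(t),\Omega_d(t))\in \mathrm{SO}(3)\times\mathbb R^3$, $t\ge0$, is a given smooth reference trajectory with $\dot R_d=R_d\hat\Omega_d$. Errors: $E_R=R-R_d$, $e_\Omega=\Omega-\Omega_d$, $e_R=\frac12(R_d^TR-R^TR_d)^\vee$, and $V_0(R,\Omega,t)=\frac{k_R}4\|E_R\|^2+\frac12\|e_\Omega\|^2$. Shifted reference: given $R(0)$, let $\theta_0\in[0,\pi]$ be the unique angle for which there is $U_0\in \mathrm{SO}(3)$ with $R(0)=U_0Z_{\theta_0}U_0^TR_d(0)$, and fix such a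 $U_0$. With $\theta_{b_0}\in(0,\theta_0)$ and $\gamma$ (which may be chosen depending on the initial attitude) set $$\theta_b(t)=\theta_{b_0}e^{-\frac\gamma2t},\quad\tilde R_d(t)=U_0Z_{\theta_b(t)}U_0^TR_d(t),\quad\tilde\Omega_d(t)=\Omega_d(t)+\dot\theta_b(t)\tilde R_d(t)^TU_0e_3,$$ so that $\dot{\tilde R}_d=\tilde R_d\hat{\tilde\Omega}_d$. The shifted errors are $\tilde e_R=\frac12(\tilde R_d^TR-R^T\tilde R_d)^\vee$ and $\tilde e_\Omega=\Omega-\tilde\Omega_d$. Convention in the definition of $\mathcal R$: the first entry of the maximum is omitted when $2a-1+\cos\theta_0<0$, and the second entry is omitted when $\theta_0=0$ (no $\theta_{b_0}\in(0,\theta_0)$ exists then). *)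

theory Defs
  imports "HOL-Analysis.Analysis"
begin

unbundle cross3_syntax

text \<open>The library norm on \<^typ>\<open>real^3^3\<close> is the Frobenius norm.\<close>

lemma norm_matrix_eq_trace:
  fixes A :: "real^'n^'m"
  shows "(norm A)\<^sup>2 = trace (transpose A ** A)"
proof -
  have "(norm A)\<^sup>2 = (\<Sum>i\<in>UNIV. \<Sum>j\<in>UNIV. A $ i $ j * A $ i $ j)"
    unfolding power2_norm_eq_inner inner_vec_def by simp
  also have "\<dots> = (\<Sum>j\<in>UNIV. \<Sum>i\<in>UNIV. A $ i $ j * A $ i $ j)"
    by (rule sum.swap)
  also have "\<dots> = trace (transpose A ** A)"
    by (simp add: trace_def matrix_matrix_mult_def transpose_def)
  finally show ?thesis .
qed

definition hat :: "real^3 \<Rightarrow> real^3^3" where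
  "hat v = matrix (\<lambda>w. v \<times> w)"

definition vee :: "real^3^3 \<Rightarrow> real^3" where
  "vee = inv hat"

lemma hat_mult: "hat v *v w = v \<times> w"
proof -
  have "linear (\<lambda>w. v \<times> w)"
    using bilinear_cross by (simp add: bilinear_def)
  then show ?thesis
    unfolding hat_def by (simp add: matrix_works linear_matrix_vector_mul_eq)
qed

lemma inj_hat: "inj hat"
proof (rule injI)
  fix v w assume "hat v = hat w"
  then have "v \<times> z = w \<times> z" for z
    by (metis hat_mult)
  from this[of "axis 1 1"] this[of "axis 2 1"] show "v = w"
    by (simp add: cross3_simps forall_3 axis_def)
qed

lemma vee_hat: "vee (hat v) = v"
  unfolding vee_def by (rule inv_f_f[OF inj_hat])

lemma hat_vee:
  assumes "transpose A = - A"
  shows "hat (vee A) = A"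
proof -
  have s: "A $ j $ i = - A $ i $ j" for i j
    using arg_cong[OF assms, of "\<lambda>M. M $ i $ j"] by (simp add: transpose_def)
  have d: "A $ i $ i = 0" for i
    using s[of i i] by simp
  have "hat (vector [A $ 3 $ 2, A $ 1 $ 3, A $ 2 $ 1]) = A"
    using s[of 2 1] s[of 3 1] s[of 3 2] d
    by (simp add: hat_def matrix_def vec_eq_iff forall_3 cross3_def axis_def)
  then show ?thesis
    by (metis vee_hat)
qed

text \<open>The library's \<^const>\<open>exp\<close> does not apply to \<^typ>\<open>real^'n^'n\<close>, whose multiplication
  is not that of matrices.\<close>

definition mat_exp :: "real^'n^'n \<Rightarrow> real^'n^'n" where
  "mat_exp A = (\<Sum>k. (1 / fact k) *\<^sub>R (((\<lambda>B. A ** B) ^^ k) (mat 1)))"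

definition e3 :: "real^3" where
  "e3 = axis 3 1"

definition Zrot :: "real \<Rightarrow> real^3^3" where
  "Zrot \<theta> = mat_exp (\<theta> *\<^sub>R hat e3)"

text \<open>Time derivative on \<open>[0, \<infinity>)\<close>, one-sided at \<open>0\<close>.\<close>

definition time_deriv :: "(real \<Rightarrow> 'a::real_normed_vector) \<Rightarrow> real \<Rightarrow> 'a" where
  "time_deriv f t = vector_derivative f (at t within {0..})"

definition smooth_nonneg :: "(real \<Rightarrow> 'a::real_normed_vector) \<Rightarrow> bool" where
  "smooth_nonneg f \<longleftrightarrow> (\<exists>D :: nat \<Rightarrow> real \<Rightarrow> 'a. (\<forall>t\<ge>0. D 0 t = f t) \<and>
     (\<forall>n. \<forall>t\<ge>0. (D n has_vector_derivative D (Suc n) t) (at t within {0..})))"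

definition reference_trajectory :: "(real \<Rightarrow> real^3^3) \<Rightarrow> (real \<Rightarrow> real^3) \<Rightarrow> bool" where
  "reference_trajectory Rd \<Omega>d \<longleftrightarrow>
     smooth_nonneg Rd \<and> smooth_nonneg \<Omega>d \<and>
     (\<forall>t\<ge>0. rotation_matrix (Rd t) \<and>
        (Rd has_vector_derivative Rd t ** hat (\<Omega>d t)) (at t within {0..}))"

definition att_err :: "real^3^3 \<Rightarrow> real^3^3 \<Rightarrow> real^3" where
  "att_err Rd R = (1/2) *\<^sub>R vee (transpose Rd ** R - transpose R ** Rd)"

definition V0 :: "real \<Rightarrow> (real \<Rightarrow> real^3^3) \<Rightarrow> (real \<Rightarrow> real^3) \<Rightarrow>
    real^3^3 \<Rightarrow> real^3 \<Rightarrow> real \<Rightarrow> real" where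
  "V0 kR Rd \<Omega>d R \<Omega> t = kR / 4 * (norm (R - Rd t))\<^sup>2 + 1/2 * (norm (\<Omega> - \<Omega>d t))\<^sup>2"

definition initial_angle :: "real^3^3 \<Rightarrow> real^3^3 \<Rightarrow> real" where
  "initial_angle Rd0 R0 = (THE \<theta>. 0 \<le> \<theta> \<and> \<theta> \<le> pi \<and>
     (\<exists>U. rotation_matrix U \<and> R0 = U ** Zrot \<theta> ** transpose U ** Rd0))"

definition shift_angle :: "real \<Rightarrow> real \<Rightarrow> real \<Rightarrow> real" where
  "shift_angle \<theta>b0 \<gamma> t = \<theta>b0 * exp (- (\<gamma> / 2) * t)"

definition shifted_R :: "real^3^3 \<Rightarrow> real \<Rightarrow> real \<Rightarrow> (real \<Rightarrow> real^3^3) \<Rightarrow> real \<Rightarrow> real^3^3" where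
  "shifted_R U0 \<theta>b0 \<gamma> Rd t = U0 ** Zrot (shift_angle \<theta>b0 \<gamma> t) ** transpose U0 ** Rd t"

definition shifted_\<Omega> :: "real^3^3 \<Rightarrow> real \<Rightarrow> real \<Rightarrow> (real \<Rightarrow> real^3^3) \<Rightarrow> (real \<Rightarrow> real^3) \<Rightarrow>
    real \<Rightarrow> real^3" where
  "shifted_\<Omega> U0 \<theta>b0 \<gamma> Rd \<Omega>d t = \<Omega>d t +
     time_deriv (shift_angle \<theta>b0 \<gamma>) t *\<^sub>R (transpose (shifted_R U0 \<theta>b0 \<gamma> Rd t) *v (U0 *v e3))"

definition track_torque :: "real^3^3 \<Rightarrow> real \<Rightarrow> real \<Rightarrow> (real \<Rightarrow> real^3^3) \<Rightarrow> (real \<Rightarrow> real^3) \<Rightarrow>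
    real \<Rightarrow> real^3^3 \<Rightarrow> real^3 \<Rightarrow> real^3" where
  "track_torque J kR k\<Omega> Rd \<Omega>d t R \<Omega> =
     - ((J *v \<Omega>) \<times> \<Omega>) +
     J *v (- kR *\<^sub>R att_err (Rd t) R - k\<Omega> *\<^sub>R (\<Omega> - \<Omega>d t) + \<Omega> \<times> \<Omega>d t + time_deriv \<Omega>d t)"

definition control :: "real^3^3 \<Rightarrow> real \<Rightarrow> real \<Rightarrow> real \<Rightarrow> real \<Rightarrow> real \<Rightarrow> real^3^3 \<Rightarrow>
    (real \<Rightarrow> real^3^3) \<Rightarrow> (real \<Rightarrow> real^3) \<Rightarrow> real^3^3 \<Rightarrow> real^3 \<Rightarrow>
    real \<Rightarrow> real^3^3 \<Rightarrow> real^3 \<Rightarrow> real^3" where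
  "control J kR k\<Omega> a \<theta>b0 \<gamma> U0 Rd \<Omega>d R0 \<Omega>0 t R \<Omega> =
     (if V0 kR Rd \<Omega>d R0 \<Omega>0 0 \<le> 2 * a * kR
      then track_torque J kR k\<Omega> Rd \<Omega>d t R \<Omega>
      else track_torque J kR k\<Omega> (shifted_R U0 \<theta>b0 \<gamma> Rd) (shifted_\<Omega> U0 \<theta>b0 \<gamma> Rd \<Omega>d) t R \<Omega>)"

text \<open>Motion on \<open>[0, T)\<close>, where \<open>T\<close> may be \<open>\<infinity>\<close>, of the rigid body under the torque law \<open>\<tau>\<close>,
  which takes time, attitude and angular velocity.\<close>

definition motion :: "real^3^3 \<Rightarrow> (real \<Rightarrow> real^3^3 \<Rightarrow> real^3 \<Rightarrow> real^3) \<Rightarrow> ereal \<Rightarrow>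
    (real \<Rightarrow> real^3^3) \<Rightarrow> (real \<Rightarrow> real^3) \<Rightarrow> bool" where
  "motion J \<tau> T R \<Omega> \<longleftrightarrow>
     (\<forall>t. 0 \<le> t \<and> ereal t < T \<longrightarrow>
        rotation_matrix (R t) \<and>
        (R has_vector_derivative R t ** hat (\<Omega> t)) (at t within {s. 0 \<le> s \<and> ereal s < T}) \<and>
        (\<exists>\<Omega>'. (\<Omega> has_vector_derivative \<Omega>') (at t within {s. 0 \<le> s \<and> ereal s < T}) \<and>
              J *v \<Omega>' = (J *v \<Omega> t) \<times> \<Omega> t + \<tau> t (R t) (\<Omega> t)))"

text \<open>Upper bound on the initial angular velocity error. The set is never empty: for
  \<open>\<theta>0 = 0\<close> and \<open>a > 0\<close> the first entry is present.\<close>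

definition velocity_bound :: "real \<Rightarrow> real \<Rightarrow> real \<Rightarrow> real \<Rightarrow> real \<Rightarrow> real \<Rightarrow> real" where
  "velocity_bound a \<epsilon> \<theta>0 \<theta>b0 \<gamma> kR = Max (
     (if 2 * a - 1 + cos \<theta>0 < 0 then {} else {sqrt (2 * kR * (2 * a - 1 + cos \<theta>0))}) \<union>
     (if \<theta>0 = 0 then {} else {2 * sqrt (a * kR * (1 - \<epsilon>)) - \<gamma> / 2 * \<theta>b0}))"

text \<open>\<open>\<theta>b0\<close> and \<open>\<gamma>\<close> are functions of the initial attitude.\<close>

definition attraction_set :: "real \<Rightarrow> real \<Rightarrow> real \<Rightarrow> (real^3^3 \<Rightarrow> real) \<Rightarrow> (real^3^3 \<Rightarrow> real) \<Rightarrow>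
    (real \<Rightarrow> real^3^3) \<Rightarrow> (real \<Rightarrow> real^3) \<Rightarrow> ((real^3^3) \<times> (real^3)) set" where
  "attraction_set kR a \<epsilon> \<theta>b0 \<gamma> Rd \<Omega>d =
     {(R0, \<Omega>0). rotation_matrix R0 \<and>
        norm (\<Omega>0 - \<Omega>d 0) < velocity_bound a \<epsilon> (initial_angle (Rd 0) R0) (\<theta>b0 R0) (\<gamma> R0) kR}"

end

theory Submission
  imports Defs
begin

text \<open>Write \<open>Q = R\<^sub>d\<^sup>T R\<close>, \<open>\<psi> = \<parallel>R - R\<^sub>d\<parallel>\<^sup>2 / 4\<close>, \<open>e\<close> for the attitude error vector and \<open>w = \<Omega> - \<Omega>\<^sub>d\<close>. Along
  the closed loop \<open>V = k\<^sub>R \<psi> + \<parallel>w\<parallel>\<^sup>2 / 2\<close> has derivative \<open>- k\<^sub>\<Omega> \<parallel>w\<parallel>\<^sup>2\<close>, because all terms with the reference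
  velocity are triple products that cancel; hence no bound on the reference is needed. If
  \<open>V \<le> 2 a k\<^sub>R\<close> initially, then \<open>\<psi> \<le> 2 a < 2\<close> for all time, and \<open>\<parallel>e\<parallel>\<^sup>2 = \<psi> (2 - \<psi>)\<close> is comparable to
  \<open>\<psi>\<close>. So for small \<open>\<mu>\<close> the function \<open>V + \<mu> e \<bullet> w\<close> is comparable to \<open>V\<close> and decays exponentially.
  For the shifted control the same argument applies to the shifted reference, which approaches
  the given one exponentially.\<close>

subsection \<open>Rotations of three-space\<close>

text \<open>The axial vector of the skew part of \<open>A\<close>. It agrees with \<open>vee\<close>
  on skew matrices but is linear on all of \<open>real^3^3\<close>, whereas \<open>inv hat\<close>
  is unspecified off the range of \<open>hat\<close>; so derivatives pass through it.\<close>

definition axial :: "real^3^3 \<Rightarrow> real^3" where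
  "axial A = (1/2) *\<^sub>R vector [A $ 3 $ 2 - A $ 2 $ 3, A $ 1 $ 3 - A $ 3 $ 1, A $ 2 $ 1 - A $ 1 $ 2]"

lemma hat_components:
  "hat v = vector [vector [0, - v $ 3, v $ 2], vector [v $ 3, 0, - v $ 1], vector [- v $ 2, v $ 1, 0]]"
  by (simp add: hat_def matrix_def vec_eq_iff forall_3 cross3_def axis_def)

lemmas mat3_simps = hat_components axial_def trace_def sum_3 matrix_matrix_mult_def
  matrix_vector_mult_def transpose_def inner_vec_def cross3_def vec_eq_iff forall_3

lemma vee_eq_axial:
  assumes "transpose A = - A"
  shows "vee A = axial A"
proof -
  have "A $ j $ i = - A $ i $ j" for i j
    using arg_cong[OF assms, of "\<lambda>M. M $ i $ j"] by (simp add: transpose_def)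
  from this[of 1 1] this[of 2 2] this[of 3 3] this[of 1 2] this[of 1 3] this[of 2 3]
  have "hat (axial A) = A"
    by (simp add: mat3_simps)
  then show ?thesis
    by (metis vee_hat)
qed

lemma transpose_diff: "transpose (A - B) = transpose A - transpose (B :: real^'n^'m)"
  by (simp add: transpose_def vec_eq_iff)

text \<open>The antisymmetrization in \<open>att_err\<close> is absorbed by \<open>axial\<close>,
  which makes the attitude error a linear function of the relative attitude.\<close>

lemma att_err_eq_axial: "att_err Rd R = axial (transpose Rd ** R)"
proof -
  let ?Q = "transpose Rd ** R"
  have "att_err Rd R = (1/2) *\<^sub>R vee (?Q - transpose ?Q)"
    by (simp add: att_err_def matrix_transpose_mul)
  also have "vee (?Q - transpose ?Q) = axial (?Q - transpose ?Q)"
    by (rule vee_eq_axial) (simp add: transpose_diff)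
  also have "(1/2) *\<^sub>R \<dots> = axial ?Q"
    by (simp add: axial_def transpose_def vec_eq_iff forall_3)
  finally show ?thesis .
qed

lemma bounded_linear_axial: "bounded_linear axial"
  unfolding linear_conv_bounded_linear[symmetric]
  by (rule linearI) (simp_all add: axial_def vec_eq_iff forall_3 field_simps)

lemma bounded_linear_trace: "bounded_linear (trace :: real^'n^'n \<Rightarrow> real)"
  unfolding linear_conv_bounded_linear[symmetric]
  by (rule linearI) (simp_all add: trace_def sum.distrib sum_distrib_left)

lemma bounded_linear_transpose: "bounded_linear (transpose :: real^'n^'m \<Rightarrow> real^'m^'n)"
  unfolding linear_conv_bounded_linear[symmetric]
  by (rule linearI) (simp_all add: transpose_def vec_eq_iff)

lemma bounded_linear_hat: "bounded_linear hat"
  unfolding linear_conv_bounded_linear[symmetric]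
  by (rule linearI) (simp_all add: mat3_simps)

lemma bounded_bilinear_matrix_mult:
  "bounded_bilinear ((**) :: real^'n^'m \<Rightarrow> real^'p^'n \<Rightarrow> real^'p^'m)"
  unfolding bilinear_conv_bounded_bilinear[symmetric] bilinear_def
  by (auto intro!: linearI simp: matrix_matrix_mult_def vec_eq_iff sum.distrib sum_distrib_left
      algebra_simps)

lemma bounded_bilinear_matrix_vector_mult:
  "bounded_bilinear ((*v) :: real^'n^'m \<Rightarrow> real^'n \<Rightarrow> real^'m)"
  unfolding bilinear_conv_bounded_bilinear[symmetric] bilinear_def
  by (auto intro!: linearI simp: matrix_vector_right_distrib matrix_vector_mult_add_rdistrib
      scaleR_matrix_vector_assoc matrix_vector_mult_scaleR)

text \<open>For a relative attitude \<open>Q\<close> and body rates \<open>x\<close>,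
  \<open>y\<close>, the matrix \<open>Q ** hat x - hat y ** Q\<close> is the time derivative of
  \<open>Q\<close>. The attitude part of the energy therefore sees only the rate difference.\<close>

lemma trace_mult_hat: "trace (Q ** hat x - hat y ** Q) = - 2 * (axial Q \<bullet> (x - y))"
  by (simp add: mat3_simps field_simps)

text \<open>Apart from the rate difference only a cross product with the reference rate
  \<open>y\<close> survives; it cancels later against the reference term in the velocity error
  equation.\<close>

lemma axial_error_rate: "axial (Q ** hat x - hat y ** Q) = axial (Q ** hat (x - y)) + axial Q \<times> y"
  by (simp add: mat3_simps field_simps)

lemma inner_axial_mult_hat: "x \<bullet> axial (Q ** hat x) = (trace Q * (x \<bullet> x) - x \<bullet> (Q *v x)) / 2"
  by (simp add: mat3_simps field_simps)

lemma trace_transpose: "trace (transpose A) = trace (A :: real^'n^'n)"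
  by (simp add: trace_def transpose_def)

lemma trace_conj:
  fixes A U :: "real^'n^'n"
  assumes "orthogonal_matrix U"
  shows "trace (U ** A ** transpose U) = trace A"
  by (metis assms matrix_mul_assoc matrix_mul_lid orthogonal_matrix_def trace_mul_sym)

lemma norm_diff_orthogonal:
  fixes A B :: "real^'n^'n"
  assumes "orthogonal_matrix A" "orthogonal_matrix B"
  shows "(norm (A - B))\<^sup>2 = 2 * (real CARD('n) - trace (transpose B ** A))"
proof -
  have "transpose (A - B) ** (A - B)
      = (mat 1 - transpose B ** A) - (transpose A ** B - mat 1)"
    using assms
    by (simp only: transpose_diff orthogonal_matrix
        bounded_bilinear.diff_left[OF bounded_bilinear_matrix_mult]
        bounded_bilinear.diff_right[OF bounded_bilinear_matrix_mult])
  moreover have "trace (transpose A ** B) = trace (transpose B ** A)"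
    by (metis trace_transpose matrix_transpose_mul transpose_transpose)
  ultimately show ?thesis
    unfolding norm_matrix_eq_trace by (simp only: trace_sub trace_I) simp
qed

text \<open>Rotations preserve cross products: write the second factor \<open>y\<close> as the image
  of \<open>transpose A *v y\<close>.\<close>

lemma hat_rotate:
  assumes "rotation_matrix A"
  shows "hat (A *v x) = A ** hat x ** transpose A"
proof -
  have "hat (A *v x) *v y = (A ** hat x ** transpose A) *v y" for y
  proof -
    have "y = A *v (transpose A *v y)"
      using assms unfolding rotation_matrix_def orthogonal_matrix_def
      by (metis matrix_vector_mul_assoc matrix_vector_mul_lid)
    then have "(A *v x) \<times> y = A *v (x \<times> (transpose A *v y))"
      by (metis cross_rotation_matrix[OF assms])
    then show ?thesis
      by (simp add: hat_mult del: transpose_matrix_vector flip: matrix_vector_mul_assoc)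
  qed
  then show ?thesis
    by (simp add: matrix_eq)
qed

lemma rotation_matrix_mult:
  fixes A B :: "real^'n^'n"
  shows "rotation_matrix A \<Longrightarrow> rotation_matrix B \<Longrightarrow> rotation_matrix (A ** B)"
  using orthogonal_matrix_mul[of A B] by (simp add: rotation_matrix_def det_mul)

lemma rotation_matrix_transpose: "rotation_matrix A \<Longrightarrow> rotation_matrix (transpose A)"
  by (simp add: rotation_matrix_def)

section \<open>Rotations about the third axis\<close>

lemma Zrot_eq: "Zrot \<theta> = vector [vector [cos \<theta>, - sin \<theta>, 0], vector [sin \<theta>, cos \<theta>, 0], vector [0, 0, 1]]"
proof -
  let ?c = "\<lambda>k. cos_coeff k *\<^sub>R \<theta> ^ k" and ?s = "\<lambda>k. sin_coeff k *\<^sub>R \<theta> ^ k"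
  \<comment> \<open>\<open>p k\<close> is the term of order \<open>k\<close> of the exponential
    series, with Taylor terms of cosine and sine as entries. Since \<open>hat e3\<close> annihilates
    \<open>e3\<close>, the last diagonal entry receives only the term \<open>k = 0\<close>.\<close>
  define p :: "nat \<Rightarrow> real^3^3" where
    "p k = vector [vector [?c k, - ?s k, 0], vector [?s k, ?c k, 0], vector [0, 0, if k = 0 then 1 else 0]]" for k
  have pow: "(((\<lambda>B. (\<theta> *\<^sub>R hat e3) ** B) ^^ k) (mat 1)) = fact k *\<^sub>R p k" for k
  proof (induction k)
    case 0
    then show ?case
      by (simp add: p_def vec_eq_iff forall_3 mat_def)
  next
    case (Suc k)
    have "(\<theta> *\<^sub>R hat e3) ** (fact k *\<^sub>R p k) = fact (Suc k) *\<^sub>R p (Suc k)"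
      by (simp add: p_def mat3_simps e3_def axis_def cos_coeff_Suc sin_coeff_Suc field_simps
          del: of_nat_Suc)
    with Suc show ?case
      by simp
  qed
  have "p sums vector [vector [cos \<theta>, - sin \<theta>, 0], vector [sin \<theta>, cos \<theta>, 0], vector [0, 0, 1]]"
    unfolding sums_def
  proof (intro vec_tendstoI)
    have "(\<lambda>k. if k = 0 then 1 else 0) sums (1 :: real)"
      using sums_single[of 0 "\<lambda>_. 1 :: real"] by simp
    then show "(\<lambda>n. sum p {..<n} $ i $ j) \<longlonglongrightarrow>
      vector [vector [cos \<theta>, - sin \<theta>, 0], vector [sin \<theta>, cos \<theta>, 0], vector [0, 0, 1 :: real] :: real^3] $ i $ j" for i j :: 3
      using exhaust_3[of i] exhaust_3[of j] cos_converges[of \<theta>] sin_converges[of \<theta>]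
        sums_minus[OF sin_converges[of \<theta>]]
      by (auto simp: p_def sums_def)
  qed
  then show ?thesis
    unfolding Zrot_def mat_exp_def pow by (simp add: sums_iff)
qed


lemma rotation_matrix_Zrot: "rotation_matrix (Zrot \<theta>)"
  using sin_cos_squared_add3[of \<theta>]
  by (simp add: rotation_matrix_def orthogonal_matrix Zrot_eq mat3_simps det_3 mat_def algebra_simps)

lemma trace_Zrot: "trace (Zrot \<theta>) = 1 + 2 * cos \<theta>"
  by (simp add: Zrot_eq mat3_simps)

lemma Zrot_diff: "transpose (Zrot \<beta>) ** Zrot \<alpha> = Zrot (\<alpha> - \<beta>)"
  by (simp add: Zrot_eq mat3_simps sin_diff cos_diff algebra_simps)

section \<open>Euler's rotation theorem\<close>

lemma rotation_matrix_has_axis: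
  assumes "rotation_matrix (Q :: real^3^3)"
  obtains v where "norm v = 1" "Q *v v = v"
proof -
  have orth: "Q ** transpose Q = mat 1" and "det Q = 1"
    using assms by (auto simp: rotation_matrix_def orthogonal_matrix_def)
  \<comment> \<open>With \<open>det Q = 1\<close> this factorization gives
    \<open>det (Q - mat 1) = det (mat 1 - Q)\<close>, while odd dimension gives the opposite sign;
    so 1 is an eigenvalue of \<open>Q\<close>.\<close>
  have "Q - mat 1 = Q ** transpose (mat 1 - Q)"
    by (simp add: transpose_diff orth bounded_bilinear.diff_right[OF bounded_bilinear_matrix_mult])
  then have "det (Q - mat 1) = det (mat 1 - Q)"
    by (metis det_mul det_transpose \<open>det Q = 1\<close> mult_1)
  moreover have "det (mat 1 - Q) = - det (Q - mat 1)"
    by (simp add: det_3 algebra_simps)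
  ultimately have "det (Q - mat 1) = 0"
    by simp
  then have "\<not> (\<exists>B. B ** (Q - mat 1) = mat 1)"
    using invertible_det_nz invertible_left_inverse by blast
  then obtain v where v: "(Q - mat 1) *v v = 0" "v \<noteq> 0"
    using matrix_left_invertible_ker by blast
  have "Q *v v = v"
    using v(1) by (simp add: matrix_vector_mult_diff_rdistrib)
  then show ?thesis
    using that[of "(1 / norm v) *\<^sub>R v"] v(2) by (simp add: matrix_vector_mult_scaleR)
qed

text \<open>Orthogonality turns the fixed third column into a fixed third row, which leaves a plane
  block; determinant 1 and orthonormality force that block to be a plane rotation.\<close>

lemma rotation_about_e3:
  assumes "rotation_matrix P" "P *v e3 = e3"
  obtains \<theta> where "0 \<le> \<theta>" "\<theta> < 2 * pi" "P = Zrot \<theta>"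
proof -
  have orth: "transpose P ** P = mat 1" and "det P = 1"
    using assms by (auto simp: rotation_matrix_def orthogonal_matrix_def)
  have c: "P $ 1 $ 3 = 0" "P $ 2 $ 3 = 0" "P $ 3 $ 3 = 1"
    using assms(2) by (simp_all add: e3_def axis_def mat3_simps)
  have "transpose P *v e3 = e3"
    using assms(2) orth by (metis matrix_vector_mul_assoc matrix_vector_mul_lid)
  then have r: "P $ 3 $ 1 = 0" "P $ 3 $ 2 = 0"
    by (simp_all add: e3_def axis_def mat3_simps del: transpose_matrix_vector)
  let ?p = "P $ 1 $ 1" and ?q = "P $ 1 $ 2" and ?r = "P $ 2 $ 1" and ?s = "P $ 2 $ 2"
  have d: "?p * ?s - ?q * ?r = 1"
    using \<open>det P = 1\<close> by (simp add: det_3 c r)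
  have n: "?p\<^sup>2 + ?r\<^sup>2 = 1" "?p * ?q + ?r * ?s = 0"
    using orth by (simp_all add: mat3_simps mat_def c r power2_eq_square)
  have "?s = ?p"
    using d n by algebra
  moreover have "?q = - ?r"
    using d n by algebra
  moreover obtain t where "0 \<le> t" "t < 2 * pi" "?p = cos t" "?r = sin t"
    using sincos_total_2pi[OF n(1)] by metis
  ultimately show ?thesis
    using that[of t] by (simp add: Zrot_eq vec_eq_iff forall_3 c r)
qed

text \<open>Conjugation by a rotation that carries \<open>e3\<close> to a fixed axis of
  \<open>Q\<close> reduces everything to rotations about \<open>e3\<close>.\<close>

theorem Euler_rotation:
  assumes "rotation_matrix (Q :: real^3^3)"
  obtains \<theta> U where "0 \<le> \<theta>" "\<theta> \<le> pi" "rotation_matrix U" "Q = U ** Zrot \<theta> ** transpose U"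
proof -
  obtain v where v: "norm v = 1" "Q *v v = v"
    using rotation_matrix_has_axis[OF assms] .
  obtain U :: "real^3^3" where U: "rotation_matrix U" "U *v e3 = v"
    using rotation_matrix_exists_basis[of v 3] v unfolding e3_def by auto
  have UU: "U ** transpose U = mat 1" "transpose U ** U = mat 1"
    using U by (auto simp: rotation_matrix_def orthogonal_matrix_def)
  let ?P = "transpose U ** Q ** U"
  have "rotation_matrix ?P"
    by (intro rotation_matrix_mult rotation_matrix_transpose assms U)
  moreover have "?P *v e3 = e3"
    by (metis U(2) v(2) UU(2) matrix_vector_mul_assoc matrix_vector_mul_lid)
  ultimately obtain t where t: "0 \<le> t" "t < 2 * pi" "?P = Zrot t"
    by (rule rotation_about_e3)
  have Q: "Q = U ** Zrot t ** transpose U"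
    by (metis UU(1) t(3) matrix_mul_assoc matrix_mul_lid matrix_mul_rid)
  show ?thesis
  proof (cases "t \<le> pi")
    case True
    then show ?thesis
      using that t(1) U(1) Q by blast
  next
    case False
    \<comment> \<open>A half-turn about the first axis reverses \<open>e3\<close>, so it replaces an
      angle \<open>t\<close> above \<open>pi\<close> by \<open>2 * pi - t\<close>.\<close>
    define F :: "real^3^3" where "F = vector [vector [1, 0, 0], vector [0, -1, 0], vector [0, 0, -1]]"
    have F: "rotation_matrix F"
      by (simp add: rotation_matrix_def orthogonal_matrix F_def mat3_simps det_3 mat_def)
    have "Zrot t = F ** Zrot (2 * pi - t) ** transpose F"
      by (simp add: F_def Zrot_eq mat3_simps)
    then have "Q = (U ** F) ** Zrot (2 * pi - t) ** transpose (U ** F)"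
      by (simp add: Q matrix_transpose_mul matrix_mul_assoc)
    then show ?thesis
      using that[of "2 * pi - t" "U ** F"] False t(2) rotation_matrix_mult[OF U(1) F] by simp
  qed
qed

lemma norm_axial: "(norm (axial A))\<^sup>2 = (trace (transpose A ** A) - trace (A ** A)) / 4"
  unfolding power2_norm_eq_inner by (simp add: mat3_simps field_simps)

text \<open>Traces are invariant under conjugation, so \<open>Zrot \<theta>\<close> decides both
  claims. In terms of the angle, the second is the identity of sin squared with (1 - cos)(1 +
  cos).\<close>

lemma rotation_trace_axial:
  assumes "rotation_matrix (Q :: real^3^3)"
  shows "trace Q \<le> 3" "(norm (axial Q))\<^sup>2 = (3 - trace Q) * (1 + trace Q) / 4"
proof -
  obtain \<theta> U where U: "rotation_matrix U" and Q: "Q = U ** Zrot \<theta> ** transpose U"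
    using Euler_rotation[OF assms] by metis
  then have "orthogonal_matrix U"
    by (simp add: rotation_matrix_def)
  note tr = trace_conj[OF this]
  have trQ: "trace Q = 1 + 2 * cos \<theta>"
    by (simp add: Q tr trace_Zrot)
  then show "trace Q \<le> 3"
    by simp
  have "Q ** Q = U ** Zrot \<theta> ** (transpose U ** U) ** Zrot \<theta> ** transpose U"
    by (simp add: Q matrix_mul_assoc)
  then have "Q ** Q = U ** (Zrot \<theta> ** Zrot \<theta>) ** transpose U"
    unfolding \<open>orthogonal_matrix U\<close>[unfolded orthogonal_matrix] by (simp add: matrix_mul_assoc)
  moreover have "trace (Zrot \<theta> ** Zrot \<theta>) = 4 * (cos \<theta>)\<^sup>2 - 1"
    using sin_squared_eq[of \<theta>] by (simp add: Zrot_eq mat3_simps flip: power2_eq_square)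
  ultimately have "trace (Q ** Q) = 4 * (cos \<theta>)\<^sup>2 - 1"
    by (simp add: tr)
  moreover have "trace (transpose Q ** Q) = 3"
    using assms by (simp add: rotation_matrix_def orthogonal_matrix trace_I)
  ultimately show "(norm (axial Q))\<^sup>2 = (3 - trace Q) * (1 + trace Q) / 4"
    unfolding norm_axial by (simp add: trQ power2_eq_square field_simps)
qed

text \<open>The trace of \<open>R0 ** transpose Rd0\<close> determines \<open>cos \<theta>\<close>,
  and cosine is injective on [0, pi]; this is the uniqueness behind the \<open>THE\<close>.\<close>

lemma initial_angle_eq:
  assumes "rotation_matrix Rd0" "rotation_matrix U" "0 \<le> \<theta>" "\<theta> \<le> pi"
    and R0: "R0 = U ** Zrot \<theta> ** transpose U ** Rd0"
  shows "initial_angle Rd0 R0 = \<theta>"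
  unfolding initial_angle_def
proof (rule the_equality)
  show "0 \<le> \<theta> \<and> \<theta> \<le> pi \<and> (\<exists>U. rotation_matrix U \<and> R0 = U ** Zrot \<theta> ** transpose U ** Rd0)"
    using assms by blast
next
  have *: "trace (R0 ** transpose Rd0) = 1 + 2 * cos \<phi>"
    if "rotation_matrix V" "R0 = V ** Zrot \<phi> ** transpose V ** Rd0" for \<phi> V
  proof -
    have "R0 ** transpose Rd0 = V ** Zrot \<phi> ** transpose V"
      using assms(1) that(2) unfolding rotation_matrix_def orthogonal_matrix_def
      by (metis matrix_mul_assoc matrix_mul_rid)
    then show ?thesis
      using that(1) by (simp add: trace_conj trace_Zrot rotation_matrix_def)
  qed
  fix \<phi>
  assume "0 \<le> \<phi> \<and> \<phi> \<le> pi \<and> (\<exists>V. rotation_matrix V \<and> R0 = V ** Zrot \<phi> ** transpose V ** Rd0)"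
  then show "\<phi> = \<theta>"
    using *[OF assms(2) R0] * cos_inj_pi[of \<phi> \<theta>] assms(3,4) by auto
qed

lemma initial_angle_nonneg:
  assumes "rotation_matrix Rd0" "rotation_matrix R0"
  shows "0 \<le> initial_angle Rd0 R0"
proof -
  obtain \<theta> U where "0 \<le> \<theta>" "\<theta> \<le> pi" and U: "rotation_matrix U"
      and "R0 ** transpose Rd0 = U ** Zrot \<theta> ** transpose U"
    using Euler_rotation[OF rotation_matrix_mult[OF assms(2) rotation_matrix_transpose[OF assms(1)]]]
    by metis
  moreover from this(4) have "R0 = U ** Zrot \<theta> ** transpose U ** Rd0"
    using assms(1) unfolding rotation_matrix_def orthogonal_matrix_def
    by (metis matrix_mul_assoc matrix_mul_rid)
  ultimately show ?thesis
    using initial_angle_eq[OF assms(1) U] by metis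
qed

subsection \<open>Closed-loop error dynamics\<close>

text \<open>For a rotation of angle \<theta> this is \<open>1 - cos \<theta>\<close>. The critical
  value 2 is reached at half-turns, where the attitude error vector vanishes as well.\<close>

definition att_dist :: "real^3^3 \<Rightarrow> real" where
  "att_dist Q = (3 - trace Q) / 2"

lemma norm_rotation_diff:
  assumes "rotation_matrix R" "rotation_matrix (S :: real^3^3)"
  shows "(norm (R - S))\<^sup>2 = 4 * att_dist (transpose S ** R)"
  using norm_diff_orthogonal[of R S] assms by (simp add: att_dist_def rotation_matrix_def)

lemma att_dist_nonneg: "rotation_matrix Q \<Longrightarrow> 0 \<le> att_dist Q"
  using rotation_trace_axial(1)[of Q] by (simp add: att_dist_def)

lemma norm_axial_att_dist:
  "rotation_matrix Q \<Longrightarrow> (norm (axial Q))\<^sup>2 = att_dist Q * (2 - att_dist Q)"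
  using rotation_trace_axial(2)[of Q] by (simp add: att_dist_def field_simps)

text \<open>Trace at most 3 and \<open>Q\<close> being an isometry bound the two summands by 3 and 1
  times the squared norm; half of their sum gives the factor 2.\<close>

lemma inner_axial_mult_hat_le:
  assumes "rotation_matrix Q"
  shows "x \<bullet> axial (Q ** hat x) \<le> 2 * (norm x)\<^sup>2"
proof -
  have "orthogonal_transformation ((*v) Q)"
    using assms by (simp add: rotation_matrix_def orthogonal_transformation_matrix)
  then have "norm (Q *v x) = norm x"
    by (rule orthogonal_transformation_norm)
  then have "\<bar>x \<bullet> (Q *v x)\<bar> \<le> (norm x)\<^sup>2"
    using Cauchy_Schwarz_ineq2[of x "Q *v x"] by (simp add: power2_eq_square)
  moreover have "trace Q * (norm x)\<^sup>2 \<le> 3 * (norm x)\<^sup>2"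
    using rotation_trace_axial(1)[OF assms] by (intro mult_right_mono) auto
  ultimately show ?thesis
    by (simp add: inner_axial_mult_hat dot_square_norm)
qed

text \<open>As \<open>d \<times> d = 0\<close>, both terms are the triple product of
  \<open>x\<close>, \<open>e\<close>, \<open>d\<close> with opposite signs. The form
  \<open>x + d\<close> matches \<Omega> as velocity error plus reference velocity.\<close>

lemma cross_error_cancel: "x \<bullet> (e \<times> d) + e \<bullet> ((x + d) \<times> d) = 0"
  by (simp add: cross3_simps)

section \<open>Differential inequalities on a compact interval\<close>

lemma nonincreasing_within:
  fixes f :: "real \<Rightarrow> real"
  assumes "0 \<le> t" "\<And>s. \<lbrakk>0 \<le> s; s \<le> t\<rbrakk> \<Longrightarrow> (f has_vector_derivative f' s) (at s within {0..t})"
    and "\<And>s. \<lbrakk>0 \<le> s; s \<le> t\<rbrakk> \<Longrightarrow> f' s \<le> 0"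
  shows "f t \<le> f 0"
proof (rule DERIV_nonpos_imp_decreasing_open[OF assms(1)])
  show "continuous_on {0..t} f"
    using assms(2) by (intro continuous_on_vector_derivative) auto
next
  fix s assume s: "0 < s" "s < t"
  \<comment> \<open>Derivatives are given relative to the closed interval; at interior points they
    are ordinary derivatives.\<close>
  then have "at s within {0..t} = at s"
    by (intro at_within_interior) auto
  then show "\<exists>y. DERIV f s :> y \<and> y \<le> 0"
    using assms(2)[of s] assms(3)[of s] s
    by (auto simp: has_real_derivative_iff_has_vector_derivative)
qed

lemma exponential_decay:
  fixes f :: "real \<Rightarrow> real"
  assumes "0 \<le> t" "\<And>s. \<lbrakk>0 \<le> s; s \<le> t\<rbrakk> \<Longrightarrow> (f has_vector_derivative f' s) (at s within {0..t})"
    and "\<And>s. \<lbrakk>0 \<le> s; s \<le> t\<rbrakk> \<Longrightarrow> f' s \<le> - c * f s"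
  shows "f t \<le> f 0 * exp (- c * t)"
proof -
  \<comment> \<open>The integrating factor \<open>exp (c * t)\<close> reduces the claim to
    monotonicity.\<close>
  have "f t * exp (c * t) \<le> f 0 * exp (c * 0)"
  proof (rule nonincreasing_within[OF assms(1)])
    fix s assume s: "0 \<le> s" "s \<le> t"
    show "((\<lambda>s. f s * exp (c * s)) has_vector_derivative (f' s + c * f s) * exp (c * s)) (at s within {0..t})"
      using assms(2)[OF s] unfolding has_real_derivative_iff_has_vector_derivative[symmetric]
      by (auto intro!: derivative_eq_intros simp: algebra_simps)
    show "(f' s + c * f s) * exp (c * s) \<le> 0"
      using assms(3)[OF s] by (simp add: mult_nonpos_nonneg)
  qed
  then show ?thesis
    by (simp add: exp_minus field_simps)
qed

lemma time_deriv_works: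
  "f differentiable (at t within {0..}) \<Longrightarrow> (f has_vector_derivative time_deriv f t) (at t within {0..})"
  unfolding time_deriv_def by (simp add: vector_derivative_works)

text \<open>Every point of the half-line, 0 included, is a limit point of it, so one-sided
  derivatives are unique.\<close>

lemma time_deriv_eq:
  assumes "(f has_vector_derivative f') (at t within {0..})" "0 \<le> t"
  shows "time_deriv f t = f'"
  unfolding time_deriv_def
proof (rule vector_derivative_within[OF _ assms(1)])
  have "t islimpt {t..t+1}"
    by (simp add: islimpt_Icc)
  then have "t islimpt {0..}"
    by (rule islimpt_subset) (use assms(2) in auto)
  then show "at t within {0..} \<noteq> bot"
    by (simp add: trivial_limit_within)
qed

text \<open>Both the given and the shifted reference satisfy this, so one convergence theorem serves
  both branches of the control.\<close>

definition tracking_reference :: "(real \<Rightarrow> real^3^3) \<Rightarrow> (real \<Rightarrow> real^3) \<Rightarrow> bool" where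
  "tracking_reference Rd \<Omega>d \<longleftrightarrow>
     (\<forall>t\<ge>0. rotation_matrix (Rd t) \<and>
        (Rd has_vector_derivative Rd t ** hat (\<Omega>d t)) (at t within {0..}) \<and>
        \<Omega>d differentiable (at t within {0..}))"

section \<open>Error equations along a motion\<close>

locale closed_loop =
  fixes J :: "real^3^3" and kR k\<Omega> :: real and Rd \<Omega>d T R \<Omega>
  assumes J_pos: "\<And>x. x \<noteq> 0 \<Longrightarrow> 0 < x \<bullet> (J *v x)"
    and ref: "tracking_reference Rd \<Omega>d"
    and motion: "motion J (track_torque J kR k\<Omega> Rd \<Omega>d) T R \<Omega>"
begin

definition Q :: "real \<Rightarrow> real^3^3" where "Q t = transpose (Rd t) ** R t"
definition w :: "real \<Rightarrow> real^3" where "w t = \<Omega> t - \<Omega>d t"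

abbreviation "\<psi> t \<equiv> att_dist (Q t)"
abbreviation "e t \<equiv> axial (Q t)"

lemma rotations:
  assumes "0 \<le> t" "ereal t < T"
  shows "rotation_matrix (R t)" "rotation_matrix (Rd t)" "rotation_matrix (Q t)"
proof -
  show "rotation_matrix (R t)" "rotation_matrix (Rd t)"
    using assms motion ref by (auto simp: motion_def tracking_reference_def)
  then show "rotation_matrix (Q t)"
    by (simp add: Q_def rotation_matrix_mult rotation_matrix_transpose)
qed

context
  fixes t s :: real
  assumes t: "ereal t < T" and s: "0 \<le> s" "s \<le> t"
begin

lemma sT: "ereal s < T"
  using s(2) t by (meson ereal_less_eq(3) le_less_trans)

text \<open>Derivatives can be restricted to the compact interval of the comparison lemmas, whether
  \<open>T\<close> is finite or not.\<close>

lemma subset_time: "{0..t} \<subseteq> {r. 0 \<le> r \<and> ereal r < T}"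
  using t by (auto intro: le_less_trans[of "ereal _" "ereal t"])

lemma Q_deriv:
  "(Q has_vector_derivative Q s ** hat (\<Omega> s) - hat (\<Omega>d s) ** Q s) (at s within {0..t})"
proof -
  have R': "(R has_vector_derivative R s ** hat (\<Omega> s)) (at s within {0..t})"
    using motion sT s by (auto simp: motion_def intro: has_vector_derivative_within_subset[OF _ subset_time])
  have "(Rd has_vector_derivative Rd s ** hat (\<Omega>d s)) (at s within {0..t})"
    using ref s by (auto simp: tracking_reference_def intro: has_vector_derivative_within_subset)
  from bounded_bilinear.has_vector_derivative[OF bounded_bilinear_matrix_mult
      bounded_linear.has_vector_derivative[OF bounded_linear_transpose this] R']
  have "(Q has_vector_derivative transpose (Rd s) ** (R s ** hat (\<Omega> s))
      + transpose (Rd s ** hat (\<Omega>d s)) ** R s) (at s within {0..t})"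
    by (simp add: Q_def[abs_def])
  moreover have "transpose (hat v) = - hat v" for v
    by (simp add: mat3_simps)
  ultimately show ?thesis
    by (simp add: Q_def matrix_transpose_mul matrix_mul_assoc
        bounded_bilinear.minus_left[OF bounded_bilinear_matrix_mult])
qed

lemma w_deriv:
  "(w has_vector_derivative - kR *\<^sub>R e s - k\<Omega> *\<^sub>R w s + \<Omega> s \<times> \<Omega>d s) (at s within {0..t})"
proof -
  obtain \<Omega>' where \<Omega>': "(\<Omega> has_vector_derivative \<Omega>') (at s within {r. 0 \<le> r \<and> ereal r < T})"
      "J *v \<Omega>' = (J *v \<Omega> s) \<times> \<Omega> s + track_torque J kR k\<Omega> Rd \<Omega>d s (R s) (\<Omega> s)"
    using motion sT s(1) unfolding motion_def by blast
  define z where "z = - kR *\<^sub>R e s - k\<Omega> *\<^sub>R w s + \<Omega> s \<times> \<Omega>d s + time_deriv \<Omega>d s"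
  have "J *v \<Omega>' = J *v z"
    by (simp add: \<Omega>'(2) track_torque_def att_err_eq_axial z_def Q_def w_def)
  \<comment> \<open>The gyroscopic terms have cancelled; positive definiteness makes
    \<open>J\<close> injective and so determines the acceleration.\<close>
  then have "J *v (\<Omega>' - z) = 0"
    by (simp add: matrix_vector_mult_diff_distrib)
  then have "\<Omega>' = z"
    using J_pos[of "\<Omega>' - z"] by force
  then have "(\<Omega> has_vector_derivative z) (at s within {0..t})"
    using \<Omega>'(1) has_vector_derivative_within_subset subset_time by blast
  moreover have "(\<Omega>d has_vector_derivative time_deriv \<Omega>d s) (at s within {0..t})"
    using ref s by (intro has_vector_derivative_within_subset[OF time_deriv_works])
      (auto simp: tracking_reference_def)
  ultimately have "(w has_vector_derivative z - time_deriv \<Omega>d s) (at s within {0..t})"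
    unfolding w_def[abs_def] by (rule has_vector_derivative_diff)
  then show ?thesis
    by (simp add: z_def)
qed

lemma energy_deriv:
  "((\<lambda>s. kR * \<psi> s + (norm (w s))\<^sup>2 / 2) has_vector_derivative - k\<Omega> * (norm (w s))\<^sup>2) (at s within {0..t})"
proof -
  have "((\<lambda>s. trace (Q s)) has_vector_derivative - 2 * (e s \<bullet> w s)) (at s within {0..t})"
    using bounded_linear.has_vector_derivative[OF bounded_linear_trace Q_deriv]
    by (simp add: trace_mult_hat w_def)
  then have "(\<psi> has_vector_derivative e s \<bullet> w s) (at s within {0..t})"
    unfolding att_dist_def has_real_derivative_iff_has_vector_derivative[symmetric]
    by (auto intro!: derivative_eq_intros)
  moreover have "((\<lambda>s. w s \<bullet> w s) has_vector_derivative
      2 * (w s \<bullet> (- kR *\<^sub>R e s - k\<Omega> *\<^sub>R w s + \<Omega> s \<times> \<Omega>d s))) (at s within {0..t})"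
    using bounded_bilinear.has_vector_derivative[OF bounded_bilinear_inner w_deriv w_deriv]
    by (simp add: inner_commute)
  ultimately have "((\<lambda>s. kR * \<psi> s + (w s \<bullet> w s) / 2) has_vector_derivative
      kR * (e s \<bullet> w s) + w s \<bullet> (- kR *\<^sub>R e s - k\<Omega> *\<^sub>R w s + \<Omega> s \<times> \<Omega>d s)) (at s within {0..t})"
    unfolding has_real_derivative_iff_has_vector_derivative[symmetric]
    by (auto intro!: derivative_eq_intros)
  \<comment> \<open>\<open>w\<close> is a difference of the two factors of the cross product. The
    terms in \<open>e s \<bullet> w s\<close> cancel because \<open>kR\<close> weights both \<psi>
    and the feedback.\<close>
  moreover have "w s \<bullet> (\<Omega> s \<times> \<Omega>d s) = 0"
    by (simp add: w_def inner_diff_left dot_cross_self)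
  ultimately show ?thesis
    by (simp add: inner_add_right inner_diff_right inner_commute dot_square_norm)
qed

text \<open>The energy dissipates only through \<open>w\<close>; the cross term supplies the missing
  negative term in the attitude error.\<close>

lemma cross_term_deriv:
  "((\<lambda>s. e s \<bullet> w s) has_vector_derivative
     w s \<bullet> axial (Q s ** hat (w s)) - kR * (norm (e s))\<^sup>2 - k\<Omega> * (e s \<bullet> w s)) (at s within {0..t})"
proof -
  have "(e has_vector_derivative axial (Q s ** hat (w s)) + e s \<times> \<Omega>d s) (at s within {0..t})"
    using bounded_linear.has_vector_derivative[OF bounded_linear_axial Q_deriv]
    by (simp add: axial_error_rate w_def)
  from bounded_bilinear.has_vector_derivative[OF bounded_bilinear_inner this w_deriv]
  have "((\<lambda>s. e s \<bullet> w s) has_vector_derivative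
     e s \<bullet> (- kR *\<^sub>R e s - k\<Omega> *\<^sub>R w s + \<Omega> s \<times> \<Omega>d s)
     + (axial (Q s ** hat (w s)) + e s \<times> \<Omega>d s) \<bullet> w s) (at s within {0..t})" .
  moreover have "w s \<bullet> (e s \<times> \<Omega>d s) + e s \<bullet> (\<Omega> s \<times> \<Omega>d s) = 0"
    using cross_error_cancel[of "w s" "e s" "\<Omega>d s"] by (simp add: w_def)
  then have "e s \<bullet> (- kR *\<^sub>R e s - k\<Omega> *\<^sub>R w s + \<Omega> s \<times> \<Omega>d s)
     + (axial (Q s ** hat (w s)) + e s \<times> \<Omega>d s) \<bullet> w s =
     w s \<bullet> axial (Q s ** hat (w s)) - kR * (norm (e s))\<^sup>2 - k\<Omega> * (e s \<bullet> w s)"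
    by (simp add: inner_add_right inner_diff_right inner_add_left dot_square_norm inner_commute)
  ultimately show ?thesis
    by simp
qed

end

lemma energy_eq_V0:
  assumes "0 \<le> t" "ereal t < T"
  shows "V0 kR Rd \<Omega>d (R t) (\<Omega> t) t = kR * \<psi> t + (norm (w t))\<^sup>2 / 2"
  using norm_rotation_diff[OF rotations(1,2)[OF assms]] by (simp add: V0_def Q_def w_def)

end

text \<open>The pointwise algebra, with \<open>E\<close> and \<open>W\<close> for the norms of
  \<open>e\<close> and \<open>w\<close>, \<open>p\<close> for their inner product and
  \<open>q\<close> for the remaining term in the derivative of \<open>p\<close>. The bounds on \<mu>
  make the perturbation at most half of \<open>V\<close> and at most half of the velocity
  dissipation.\<close>

lemma lyapunov_estimates:
  fixes kR k\<Omega> a \<mu> \<psi> E W p q :: real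
  assumes "0 < kR" "0 < k\<Omega>" "a < 1" "0 < \<mu>" "\<mu> \<le> kR / 2" "\<mu> \<le> 1 / 2"
    and \<mu>: "\<mu> * (2 + k\<Omega>\<^sup>2 / (2 * kR)) \<le> k\<Omega> / 2"
    and \<psi>: "0 \<le> \<psi>" "\<psi> \<le> 2 * a" and E: "E\<^sup>2 = \<psi> * (2 - \<psi>)"
    and p: "\<bar>p\<bar> \<le> E * W" and q: "q \<le> 2 * W\<^sup>2"
  defines "V \<equiv> kR * \<psi> + W\<^sup>2 / 2"
  shows "V \<le> 2 * (V + \<mu> * p)" "V + \<mu> * p \<le> 2 * V"
    and "- k\<Omega> * W\<^sup>2 + \<mu> * (q - kR * E\<^sup>2 - k\<Omega> * p) \<le> - (min k\<Omega> (\<mu> * (1 - a)) / 2) * (V + \<mu> * p)"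
proof -
  \<comment> \<open>Here \<psi> staying below 2 matters: \<open>2 - \<psi>\<close> is at least
    \<open>2 * (1 - a)\<close>.\<close>
  have E_le: "E\<^sup>2 \<le> 2 * \<psi>" and E_ge: "2 * (1 - a) * \<psi> \<le> E\<^sup>2"
    using \<psi> mult_left_mono[of "2 - 2 * a" "2 - \<psi>" \<psi>] unfolding E by (auto simp: algebra_simps)
  have "E * W \<le> E\<^sup>2 / 2 + W\<^sup>2 / 2"
    using sum_squares_ge_zero[of "E - W" 0] by (simp add: power2_eq_square algebra_simps)
  then have "\<bar>p\<bar> \<le> \<psi> + W\<^sup>2 / 2"
    using p E_le by linarith
  then have "\<mu> * \<bar>p\<bar> \<le> \<mu> * \<psi> + \<mu> * (W\<^sup>2 / 2)"
    using \<open>0 < \<mu>\<close> by (metis distrib_left less_imp_le mult_left_mono)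
  also have "\<dots> \<le> kR / 2 * \<psi> + 1 / 2 * (W\<^sup>2 / 2)"
    using assms(5,6) \<psi> by (intro add_mono mult_right_mono) auto
  finally have "\<bar>\<mu> * p\<bar> \<le> V / 2"
    using \<open>0 < \<mu>\<close> by (simp add: V_def abs_mult)
  moreover have "0 \<le> V"
    using \<psi> \<open>0 < kR\<close> by (simp add: V_def)
  ultimately show "V \<le> 2 * (V + \<mu> * p)" and upper: "V + \<mu> * p \<le> 2 * V"
    by (simp_all add: abs_le_iff)
  let ?m = "min k\<Omega> (\<mu> * (1 - a))"
  \<comment> \<open>Completing this square trades the mixed term for half of
    \<open>kR * E\<^sup>2\<close> and a multiple of \<open>W\<^sup>2\<close>.\<close>
  have "0 \<le> (kR * E - k\<Omega> * W)\<^sup>2 / (2 * kR)"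
    using \<open>0 < kR\<close> by simp
  also have "\<dots> = kR / 2 * E\<^sup>2 + k\<Omega>\<^sup>2 / (2 * kR) * W\<^sup>2 - k\<Omega> * (E * W)"
    using \<open>0 < kR\<close> by (simp add: field_simps power2_eq_square)
  finally have "- (k\<Omega> * p) \<le> kR / 2 * E\<^sup>2 + k\<Omega>\<^sup>2 / (2 * kR) * W\<^sup>2"
    using p mult_left_mono[of "- p" "E * W" k\<Omega>] \<open>0 < k\<Omega>\<close> by (simp add: abs_le_iff)
  then have "q - kR * E\<^sup>2 - k\<Omega> * p \<le> (2 + k\<Omega>\<^sup>2 / (2 * kR)) * W\<^sup>2 - kR / 2 * E\<^sup>2"
    using q by (simp add: algebra_simps)
  also have "\<dots> \<le> (2 + k\<Omega>\<^sup>2 / (2 * kR)) * W\<^sup>2 - kR * (1 - a) * \<psi>"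
    using mult_left_mono[OF E_ge, of "kR / 2"] \<open>0 < kR\<close> by (simp add: algebra_simps)
  finally have "q - kR * E\<^sup>2 - k\<Omega> * p \<le> (2 + k\<Omega>\<^sup>2 / (2 * kR)) * W\<^sup>2 - kR * (1 - a) * \<psi>" .
  from mult_left_mono[OF this, of \<mu>] have "\<mu> * (q - kR * E\<^sup>2 - k\<Omega> * p)
      \<le> \<mu> * (2 + k\<Omega>\<^sup>2 / (2 * kR)) * W\<^sup>2 - \<mu> * (1 - a) * (kR * \<psi>)"
    using \<open>0 < \<mu>\<close> by (simp add: algebra_simps)
  also have "\<dots> \<le> k\<Omega> / 2 * W\<^sup>2 - \<mu> * (1 - a) * (kR * \<psi>)"
    using mult_right_mono[OF \<mu>, of "W\<^sup>2"] by simp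
  finally have "- k\<Omega> * W\<^sup>2 + \<mu> * (q - kR * E\<^sup>2 - k\<Omega> * p) \<le> - (k\<Omega> * (W\<^sup>2 / 2)) - \<mu> * (1 - a) * (kR * \<psi>)"
    by simp
  \<comment> \<open>The rates of the two parts of \<open>V\<close> are \<open>k\<Omega>\<close> and
    \<open>\<mu> * (1 - a)\<close>; the smaller one serves for both.\<close>
  also have "\<dots> \<le> - (?m * (W\<^sup>2 / 2)) - ?m * (kR * \<psi>)"
    using \<psi> \<open>0 < kR\<close> by (intro diff_mono mult_right_mono) (auto intro: mult_right_mono)
  also have "\<dots> = - (?m * V)"
    by (simp add: V_def algebra_simps)
  \<comment> \<open>The rate is halved because \<open>V + \<mu> * p\<close> may be as large as
    \<open>2 * V\<close>.\<close>
  also have "\<dots> \<le> - (?m / 2) * (V + \<mu> * p)"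
    using mult_left_mono[OF upper, of "?m"] assms(2-4) by simp
  finally show "- k\<Omega> * W\<^sup>2 + \<mu> * (q - kR * E\<^sup>2 - k\<Omega> * p) \<le> - (?m / 2) * (V + \<mu> * p)" .
qed

text \<open>Monotonicity of the energy comes first: it keeps \<open>\<psi> s \<le> 2 * a\<close> up
  to time \<open>t\<close>, which the estimates for the perturbed function require. The factor 8 is
  the initial bound \<open>2 * a * kR\<close> with a factor 2 from each comparison.\<close>

lemma (in closed_loop) energy_decay:
  assumes gains: "0 < kR" "0 < k\<Omega>" and "a < 1"
    and \<mu>: "0 < \<mu>" "\<mu> \<le> kR / 2" "\<mu> \<le> 1 / 2" "\<mu> * (2 + k\<Omega>\<^sup>2 / (2 * kR)) \<le> k\<Omega> / 2"
    and init: "V0 kR Rd \<Omega>d (R 0) (\<Omega> 0) 0 \<le> 2 * a * kR"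
    and t: "0 \<le> t" "ereal t < T"
  shows "kR * \<psi> t + (norm (w t))\<^sup>2 / 2 \<le> 8 * a * kR * exp (- (min k\<Omega> (\<mu> * (1 - a)) / 2) * t)"
proof -
  let ?V = "\<lambda>s. kR * \<psi> s + (norm (w s))\<^sup>2 / 2" and ?m = "min k\<Omega> (\<mu> * (1 - a))"
  let ?L = "\<lambda>s. ?V s + \<mu> * (e s \<bullet> w s)"
  have sT: "ereal s < T" if "s \<le> t" for s
    using that t(2) by (meson ereal_less_eq(3) le_less_trans)
  have "?V 0 \<le> 2 * a * kR"
    using init energy_eq_V0[of 0] sT t(1) by (simp add: zero_ereal_def)
  note est = lyapunov_estimates[OF gains \<open>a < 1\<close> \<mu> att_dist_nonneg _ norm_axial_att_dist
      Cauchy_Schwarz_ineq2 inner_axial_mult_hat_le]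
  have rot: "rotation_matrix (Q s)" and \<psi>_le: "\<psi> s \<le> 2 * a" if s: "0 \<le> s" "s \<le> t" for s
  proof -
    have "?V s \<le> ?V 0"
      using gains s sT by (intro nonincreasing_within[OF s(1) energy_deriv]) auto
    then have "kR * \<psi> s \<le> 2 * a * kR"
      using \<open>?V 0 \<le> 2 * a * kR\<close> zero_le_power2[of "norm (w s)"] by linarith
    then show "\<psi> s \<le> 2 * a"
      using \<open>0 < kR\<close> by (simp add: mult.commute)
    show "rotation_matrix (Q s)"
      using rotations(3) s sT by blast
  qed
  have "?V t \<le> 2 * ?L t"
    using est(1)[OF rot \<psi>_le rot rot] t by blast
  moreover have "?L t \<le> ?L 0 * exp (- (?m / 2) * t)"
  proof (rule exponential_decay[OF t(1)])
    fix s
    assume s: "0 \<le> s" "s \<le> t"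
    show "(?L has_vector_derivative - k\<Omega> * (norm (w s))\<^sup>2 +
        \<mu> * (w s \<bullet> axial (Q s ** hat (w s)) - kR * (norm (e s))\<^sup>2 - k\<Omega> * (e s \<bullet> w s)))
        (at s within {0..t})"
      using energy_deriv[OF t(2) s] cross_term_deriv[OF t(2) s]
      by (intro has_vector_derivative_add
          bounded_linear.has_vector_derivative[OF bounded_linear_mult_right])
    show "- k\<Omega> * (norm (w s))\<^sup>2 +
        \<mu> * (w s \<bullet> axial (Q s ** hat (w s)) - kR * (norm (e s))\<^sup>2 - k\<Omega> * (e s \<bullet> w s))
        \<le> - (?m / 2) * ?L s"
      using est(3)[OF rot \<psi>_le rot rot] s by blast
  qed
  moreover have "?L 0 \<le> 2 * ?V 0"
    using est(2)[OF rot \<psi>_le rot rot] t by blast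
  ultimately have "?V t \<le> 2 * (2 * ?V 0 * exp (- (?m / 2) * t))"
    by (meson exp_ge_zero mult_left_mono mult_right_mono order_trans zero_le_numeral)
  also have "\<dots> \<le> 2 * (2 * (2 * a * kR) * exp (- (?m / 2) * t))"
    using \<open>?V 0 \<le> 2 * a * kR\<close> by simp
  finally show ?thesis
    by simp
qed

text \<open>The square root halves the rate; the slack in \<open>C\<close> lets both errors share
  one constant.\<close>

lemma power2_le_exp_imp_le:
  fixes x :: real
  assumes "x\<^sup>2 \<le> B * exp (- c * t)" "0 \<le> B" "sqrt B \<le> C"
  shows "x \<le> C * exp (- (c / 2) * t)"
proof -
  have "(sqrt B * exp (- (c / 2) * t))\<^sup>2 = B * exp (- c * t)"
    using assms(2) exp_double[of "- (c / 2) * t"] by (simp add: power_mult_distrib)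
  then have "x \<le> sqrt B * exp (- (c / 2) * t)"
    using assms(1,2) by (auto intro: power2_le_imp_le)
  also have "\<dots> \<le> C * exp (- (c / 2) * t)"
    using assms(3) by (intro mult_right_mono) auto
  finally show ?thesis .
qed

text \<open>The constants precede \<open>T\<close>, \<open>R\<close> and \<Omega>, so they are
  uniform over all motions starting in the sublevel set.\<close>

theorem exponential_tracking:
  fixes J :: "real^3^3"
  assumes J_pos: "\<And>x. x \<noteq> 0 \<Longrightarrow> 0 < x \<bullet> (J *v x)"
    and ref: "tracking_reference Rd \<Omega>d"
    and gains: "0 < kR" "0 < k\<Omega>" and a: "0 < a" "a < 1"
  shows "\<exists>C>0. \<exists>\<alpha>>0. \<forall>T R \<Omega>.
     motion J (track_torque J kR k\<Omega> Rd \<Omega>d) T R \<Omega> \<and> V0 kR Rd \<Omega>d (R 0) (\<Omega> 0) 0 \<le> 2 * a * kR \<longrightarrow>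
     (\<forall>t. 0 \<le> t \<and> ereal t < T \<longrightarrow>
        norm (R t - Rd t) \<le> C * exp (- \<alpha> * t) \<and> norm (\<Omega> t - \<Omega>d t) \<le> C * exp (- \<alpha> * t))"
proof -
  \<comment> \<open>The three entries are the upper bounds on \<mu> in
    \<open>lyapunov_estimates\<close>.\<close>
  define \<mu> where "\<mu> = Min {kR / 2, 1 / 2, k\<Omega> / 2 / (2 + k\<Omega>\<^sup>2 / (2 * kR))}"
  have pos: "0 < 2 + k\<Omega>\<^sup>2 / (2 * kR)"
    using gains by (intro add_pos_pos divide_pos_pos) auto
  have \<mu>: "\<mu> \<le> kR / 2" "\<mu> \<le> 1 / 2" "\<mu> \<le> k\<Omega> / 2 / (2 + k\<Omega>\<^sup>2 / (2 * kR))"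
    unfolding \<mu>_def by (rule Min_le; simp)+
  have "0 < \<mu>"
    unfolding \<mu>_def using gains pos by (subst Min_gr_iff) simp_all
  have \<mu>': "\<mu> * (2 + k\<Omega>\<^sup>2 / (2 * kR)) \<le> k\<Omega> / 2"
    using \<mu>(3) pos by (simp only: pos_le_divide_eq)
  define c where "c = min k\<Omega> (\<mu> * (1 - a)) / 2"
  have "0 < c"
    using gains a \<open>0 < \<mu>\<close> by (simp add: c_def)
  \<comment> \<open>Each summand of \<open>V0\<close> is at most \<open>8 * a * kR\<close> times the
    exponential; dividing by \<open>kR / 4\<close> and by \<open>1 / 2\<close> gives the two
    radicands.\<close>
  define C where "C = sqrt (32 * a) + sqrt (16 * a * kR)"
  have "norm (R t - Rd t) \<le> C * exp (- (c / 2) * t) \<and> norm (\<Omega> t - \<Omega>d t) \<le> C * exp (- (c / 2) * t)"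
    if "motion J (track_torque J kR k\<Omega> Rd \<Omega>d) T R \<Omega>" "V0 kR Rd \<Omega>d (R 0) (\<Omega> 0) 0 \<le> 2 * a * kR"
      and t: "0 \<le> t" "ereal t < T" for T R \<Omega> t
  proof -
    interpret closed_loop J kR k\<Omega> Rd \<Omega>d T R \<Omega>
      using J_pos ref that(1) by unfold_locales
    have "V0 kR Rd \<Omega>d (R t) (\<Omega> t) t \<le> 8 * a * kR * exp (- c * t)"
      unfolding energy_eq_V0[OF t] c_def
      by (rule energy_decay[OF gains a(2) \<open>0 < \<mu>\<close> \<mu>(1,2) \<mu>' that(2) t])
    then have "kR / 4 * (norm (R t - Rd t))\<^sup>2 \<le> 8 * a * kR * exp (- c * t)"
        and "1 / 2 * (norm (\<Omega> t - \<Omega>d t))\<^sup>2 \<le> 8 * a * kR * exp (- c * t)"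
      using gains zero_le_power2[of "norm (\<Omega> t - \<Omega>d t)"]
        mult_nonneg_nonneg[OF _ zero_le_power2[of "norm (R t - Rd t)"], of "kR / 4"]
      unfolding V0_def by linarith+
    then have "(norm (R t - Rd t))\<^sup>2 \<le> 32 * a * exp (- c * t)"
        and "(norm (\<Omega> t - \<Omega>d t))\<^sup>2 \<le> 16 * a * kR * exp (- c * t)"
      using gains by (simp_all add: field_simps)
    then show ?thesis
      using gains a by (intro conjI power2_le_exp_imp_le[of _ "32 * a" c]
          power2_le_exp_imp_le[of _ "16 * a * kR" c]) (simp_all add: C_def)
  qed
  moreover have "0 < C"
    using gains a by (simp add: C_def add_pos_pos)
  ultimately show ?thesis
    using \<open>0 < c\<close> by (intro exI[of _ C] conjI exI[of _ "c / 2"]) auto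
qed

subsection \<open>The shifted reference\<close>

lemma Zrot_deriv: "(Zrot has_vector_derivative Zrot \<theta> ** hat e3) (at \<theta> within S)"
proof -
  \<comment> \<open>The projection to the plane orthogonal to \<open>e3\<close>; with it
    \<open>Zrot\<close> is affine in cosine and sine.\<close>
  define D :: "real^3^3" where "D = vector [vector [1, 0, 0], vector [0, 1, 0], vector [0, 0, 0]]"
  have Z: "Zrot = (\<lambda>\<theta>. cos \<theta> *\<^sub>R D + sin \<theta> *\<^sub>R hat e3 + (mat 1 - D))"
    by (simp add: fun_eq_iff Zrot_eq D_def mat3_simps mat_def e3_def axis_def)
  have "Zrot \<theta> ** hat e3 = - sin \<theta> *\<^sub>R D + cos \<theta> *\<^sub>R hat e3"
    by (simp add: Zrot_eq D_def mat3_simps e3_def axis_def)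
  then show ?thesis
    unfolding Z by (auto intro!: derivative_eq_intros)
qed

lemma Zrot_hat_e3: "Zrot \<theta> ** hat e3 = hat e3 ** Zrot \<theta>"
  by (simp add: Zrot_eq mat3_simps e3_def axis_def)

lemma Zrot_0: "Zrot 0 = mat 1"
  by (simp add: Zrot_eq mat_def vec_eq_iff forall_3)

text \<open>The relative rotation is \<open>Zrot (\<alpha> - \<beta>)\<close> conjugated by
  \<open>transpose S ** U\<close>, so the distance depends on the angle difference alone.\<close>

lemma norm_conj_Zrot_diff:
  assumes "rotation_matrix U" "rotation_matrix S"
  shows "(norm (U ** Zrot \<alpha> ** transpose U ** S - U ** Zrot \<beta> ** transpose U ** S))\<^sup>2
    = 4 * (1 - cos (\<alpha> - \<beta>))"
proof -
  let ?A = "\<lambda>\<theta>. U ** Zrot \<theta> ** transpose U ** S"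
  have rot: "rotation_matrix (?A \<theta>)" for \<theta>
    by (intro rotation_matrix_mult rotation_matrix_transpose rotation_matrix_Zrot assms)
  have U: "transpose U ** U = mat 1"
    using assms by (simp add: rotation_matrix_def orthogonal_matrix)
  have "transpose (?A \<beta>) ** ?A \<alpha>
      = transpose S ** U ** transpose (Zrot \<beta>) ** (transpose U ** U) ** Zrot \<alpha> ** transpose U ** S"
    by (simp add: matrix_transpose_mul matrix_mul_assoc)
  also have "\<dots> = transpose S ** U ** (transpose (Zrot \<beta>) ** Zrot \<alpha>) ** transpose U ** S"
    unfolding U by (simp add: matrix_mul_assoc)
  also have "\<dots> = (transpose S ** U) ** Zrot (\<alpha> - \<beta>) ** transpose (transpose S ** U)"
    unfolding Zrot_diff by (simp add: matrix_transpose_mul matrix_mul_assoc)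
  finally have "trace (transpose (?A \<beta>) ** ?A \<alpha>) = 1 + 2 * cos (\<alpha> - \<beta>)"
    using rotation_matrix_mult[OF rotation_matrix_transpose[OF assms(2)] assms(1)]
    by (simp add: trace_conj trace_Zrot rotation_matrix_def)
  then show ?thesis
    using norm_rotation_diff[OF rot rot, of \<alpha> \<beta>] by (simp add: att_dist_def)
qed

lemma norm_conj_Zrot_diff_base:
  assumes "rotation_matrix U" "rotation_matrix S"
  shows "(norm (U ** Zrot \<alpha> ** transpose U ** S - S))\<^sup>2 = 4 * (1 - cos \<alpha>)"
proof -
  have "U ** Zrot 0 ** transpose U ** S = S"
    using assms(1) by (simp add: Zrot_0 rotation_matrix_def orthogonal_matrix_def)
  then show ?thesis
    using norm_conj_Zrot_diff[OF assms, of \<alpha> 0] by simp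
qed

lemma one_minus_cos_le: "1 - cos x \<le> x\<^sup>2 / 2" for x :: real
proof -
  have "(sin (x / 2))\<^sup>2 \<le> (x / 2)\<^sup>2"
    using abs_sin_x_le_abs_x[of "x / 2"] by (simp only: abs_le_square_iff)
  then show ?thesis
    using cos_double_sin[of "x / 2"] by (simp add: power_divide)
qed

lemma shift_angle_deriv:
  "(shift_angle \<theta>b0 \<gamma> has_real_derivative - (\<gamma> / 2) * shift_angle \<theta>b0 \<gamma> t) (at t within S)"
  unfolding shift_angle_def[abs_def] by (auto intro!: derivative_eq_intros)

lemma time_deriv_shift_angle:
  "0 \<le> t \<Longrightarrow> time_deriv (shift_angle \<theta>b0 \<gamma>) t = - (\<gamma> / 2) * shift_angle \<theta>b0 \<gamma> t"
  by (rule time_deriv_eq[OF shift_angle_deriv[unfolded has_real_derivative_iff_has_vector_derivative]])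

lemma rotation_matrix_shifted_R:
  "rotation_matrix U0 \<Longrightarrow> rotation_matrix (Rd t) \<Longrightarrow> rotation_matrix (shifted_R U0 \<theta>b0 \<gamma> Rd t)"
  unfolding shifted_R_def
  by (intro rotation_matrix_mult rotation_matrix_transpose rotation_matrix_Zrot)

text \<open>By the chain rule the moving factor \<open>Zrot\<close> adds a rotation about the
  spatial axis \<open>U0 *v e3\<close>; in the body frame this is the correction in
  \<open>shifted_\<Omega>\<close>.\<close>

lemma tracking_reference_shifted:
  assumes ref: "tracking_reference Rd \<Omega>d" and U0: "rotation_matrix U0"
  shows "tracking_reference (shifted_R U0 \<theta>b0 \<gamma> Rd) (shifted_\<Omega> U0 \<theta>b0 \<gamma> Rd \<Omega>d)"
  unfolding tracking_reference_def
proof (intro allI impI conjI)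
  fix t :: real
  assume t: "0 \<le> t"
  let ?S = "shifted_R U0 \<theta>b0 \<gamma> Rd" and ?\<theta> = "shift_angle \<theta>b0 \<gamma>"
  let ?\<theta>' = "\<lambda>t. - (\<gamma> / 2) * shift_angle \<theta>b0 \<gamma> t"
  have Rd: "rotation_matrix (Rd t)" "(Rd has_vector_derivative Rd t ** hat (\<Omega>d t)) (at t within {0..})"
      "\<Omega>d differentiable (at t within {0..})"
    using ref t by (auto simp: tracking_reference_def)
  show rot: "rotation_matrix (?S t)"
    using U0 Rd(1) by (rule rotation_matrix_shifted_R)
  note mult = bounded_bilinear.has_vector_derivative[OF bounded_bilinear_matrix_mult]
  have "((\<lambda>t. Zrot (?\<theta> t)) has_vector_derivative ?\<theta>' t *\<^sub>R (Zrot (?\<theta> t) ** hat e3)) (at t within {0..})"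
    using vector_diff_chain_within[OF shift_angle_deriv[unfolded has_real_derivative_iff_has_vector_derivative] Zrot_deriv]
    by (simp add: o_def)
  from mult[OF mult[OF mult[OF has_vector_derivative_const this, of U0]
        has_vector_derivative_const, of "transpose U0"] Rd(2)]
  have S': "(?S has_vector_derivative ?S t ** hat (\<Omega>d t)
      + ?\<theta>' t *\<^sub>R (U0 ** (Zrot (?\<theta> t) ** hat e3) ** transpose U0 ** Rd t)) (at t within {0..})"
    unfolding shifted_R_def[abs_def]
    by (simp add: matrix_mul_assoc bounded_bilinear.scaleR_left[OF bounded_bilinear_matrix_mult]
        bounded_bilinear.scaleR_right[OF bounded_bilinear_matrix_mult]
        bounded_bilinear.zero_left[OF bounded_bilinear_matrix_mult]
        bounded_bilinear.zero_right[OF bounded_bilinear_matrix_mult]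
        bounded_bilinear.minus_left[OF bounded_bilinear_matrix_mult]
        bounded_bilinear.minus_right[OF bounded_bilinear_matrix_mult])
  \<comment> \<open>Conjugation by \<open>?S t\<close> moves the axis from body to space
    coordinates; \<open>Zrot\<close> then commutes with \<open>hat e3\<close>.\<close>
  have "?S t ** hat (transpose (?S t) *v (U0 *v e3)) = hat (U0 *v e3) ** ?S t"
  proof -
    have "?S t ** transpose (?S t) = mat 1"
      using rot by (simp add: rotation_matrix_def orthogonal_matrix_def)
    then show ?thesis
      using hat_rotate[OF rotation_matrix_transpose[OF rot], of "U0 *v e3"]
      by (simp add: matrix_mul_assoc del: transpose_matrix_vector)
  qed
  also have "\<dots> = U0 ** hat e3 ** (transpose U0 ** U0) ** Zrot (?\<theta> t) ** transpose U0 ** Rd t"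
    by (simp add: hat_rotate[OF U0] shifted_R_def matrix_mul_assoc)
  also have "\<dots> = U0 ** (Zrot (?\<theta> t) ** hat e3) ** transpose U0 ** Rd t"
    using U0 unfolding rotation_matrix_def orthogonal_matrix Zrot_hat_e3
    by (simp add: matrix_mul_assoc)
  finally have hat_axis: "?S t ** hat (transpose (?S t) *v (U0 *v e3))
      = U0 ** (Zrot (?\<theta> t) ** hat e3) ** transpose U0 ** Rd t" .
  have "?S t ** hat (shifted_\<Omega> U0 \<theta>b0 \<gamma> Rd \<Omega>d t)
      = ?S t ** hat (\<Omega>d t) + ?\<theta>' t *\<^sub>R (?S t ** hat (transpose (?S t) *v (U0 *v e3)))"
    unfolding shifted_\<Omega>_def time_deriv_shift_angle[OF t]
    by (simp only: linear_add[OF bounded_linear.linear[OF bounded_linear_hat]]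
        linear_scale[OF bounded_linear.linear[OF bounded_linear_hat]]
        matrix_add_ldistrib bounded_bilinear.scaleR_right[OF bounded_bilinear_matrix_mult])
  then show "(?S has_vector_derivative ?S t ** hat (shifted_\<Omega> U0 \<theta>b0 \<gamma> Rd \<Omega>d t)) (at t within {0..})"
    using S' by (simp only: hat_axis)
  have "((\<lambda>t. transpose (?S t) *v (U0 *v e3)) has_vector_derivative
      transpose (?S t) *v 0 + transpose (?S t ** hat (shifted_\<Omega> U0 \<theta>b0 \<gamma> Rd \<Omega>d t)) *v (U0 *v e3)) (at t within {0..})"
    by (intro bounded_bilinear.has_vector_derivative[OF bounded_bilinear_matrix_vector_mult]
        has_vector_derivative_const bounded_linear.has_vector_derivative[OF bounded_linear_transpose])
      fact
  then have "(\<lambda>t. transpose (?S t) *v (U0 *v e3)) differentiable (at t within {0..})"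
    by (rule differentiableI_vector)
  moreover have "?\<theta>' differentiable (at t within {0..})"
    using DERIV_cmult[OF shift_angle_deriv]
    unfolding has_real_derivative_iff_has_vector_derivative by (rule differentiableI_vector)
  ultimately have "(\<lambda>t. \<Omega>d t + ?\<theta>' t *\<^sub>R (transpose (?S t) *v (U0 *v e3))) differentiable (at t within {0..})"
    using Rd(3) by (intro differentiable_add differentiable_scaleR)
  \<comment> \<open>The closed form of \<open>time_deriv\<close> was established at nonnegative
    times, hence the transfer within the half-line.\<close>
  then show "shifted_\<Omega> U0 \<theta>b0 \<gamma> Rd \<Omega>d differentiable (at t within {0..})"
    by (rule differentiable_transform_within[OF _ zero_less_one])
      (use t in \<open>auto simp: shifted_\<Omega>_def time_deriv_shift_angle\<close>)
qed

lemma shifted_R_close: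
  assumes "rotation_matrix U0" "rotation_matrix (Rd t)" "0 \<le> \<theta>b0"
  shows "norm (shifted_R U0 \<theta>b0 \<gamma> Rd t - Rd t) \<le> 2 * \<theta>b0 * exp (- (\<gamma> / 2) * t)"
proof (rule power2_le_imp_le)
  let ?\<theta> = "shift_angle \<theta>b0 \<gamma> t"
  have "(norm (shifted_R U0 \<theta>b0 \<gamma> Rd t - Rd t))\<^sup>2 \<le> 4 * (?\<theta>\<^sup>2 / 2)"
    unfolding shifted_R_def norm_conj_Zrot_diff_base[OF assms(1,2)]
    using one_minus_cos_le[of ?\<theta>] by simp
  also have "\<dots> \<le> (2 * ?\<theta>)\<^sup>2"
    by (simp add: power_mult_distrib)
  finally show "(norm (shifted_R U0 \<theta>b0 \<gamma> Rd t - Rd t))\<^sup>2 \<le> (2 * \<theta>b0 * exp (- (\<gamma> / 2) * t))\<^sup>2"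
    by (simp add: shift_angle_def mult.assoc)
qed (use assms(3) in simp)

text \<open>The correction is the rate of the shift angle times a unit vector, since rotations
  preserve the norm of \<open>e3\<close>.\<close>

lemma shifted_\<Omega>_dist:
  assumes "rotation_matrix U0" "rotation_matrix (Rd t)" "0 \<le> t" "0 \<le> \<theta>b0" "0 \<le> \<gamma>"
  shows "norm (shifted_\<Omega> U0 \<theta>b0 \<gamma> Rd \<Omega>d t - \<Omega>d t) = \<gamma> / 2 * \<theta>b0 * exp (- (\<gamma> / 2) * t)"
proof -
  have iso: "norm (A *v x) = norm x" if "rotation_matrix A" for A :: "real^3^3" and x
    using that by (intro orthogonal_transformation_norm)
      (simp add: rotation_matrix_def orthogonal_transformation_matrix)
  have "norm (transpose (shifted_R U0 \<theta>b0 \<gamma> Rd t) *v (U0 *v e3)) = 1"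
    using rotation_matrix_transpose[OF rotation_matrix_shifted_R[where Rd = Rd and t = t, OF assms(1,2)]] assms(1)
    by (simp only: iso) (simp add: e3_def norm_axis_1)
  then show ?thesis
    using assms(3-5)
    by (simp add: shifted_\<Omega>_def time_deriv_shift_angle shift_angle_def abs_mult del: transpose_matrix_vector)
qed

section \<open>The bound on the initial velocity error\<close>

lemma velocity_bound_cases:
  assumes "x < velocity_bound a \<epsilon> \<theta>0 \<theta>b0 \<gamma> kR" "0 \<le> a"
  obtains "x < sqrt (2 * kR * (2 * a - 1 + cos \<theta>0))" "0 \<le> 2 * a - 1 + cos \<theta>0"
    | "x < 2 * sqrt (a * kR * (1 - \<epsilon>)) - \<gamma> / 2 * \<theta>b0" "\<theta>0 \<noteq> 0"
  \<comment> \<open>Both entries cannot be absent: at \<open>\<theta>0 = 0\<close> the first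
    condition reads \<open>2 * a < 0\<close>.\<close>
  using assms unfolding velocity_bound_def
  by (cases "2 * a - 1 + cos \<theta>0 < 0"; cases "\<theta>0 = 0") (auto simp: less_max_iff_disj)

lemma velocity_bound_zero_angle:
  "0 \<le> a \<Longrightarrow> velocity_bound a \<epsilon> 0 \<theta>b0 \<gamma> kR = sqrt (4 * a * kR)"
  by (simp add: velocity_bound_def mult_ac)

lemma velocity_bound_ge:
  "\<theta>0 \<noteq> 0 \<Longrightarrow> 2 * sqrt (a * kR * (1 - \<epsilon>)) - \<gamma> / 2 * \<theta>b0 \<le> velocity_bound a \<epsilon> \<theta>0 \<theta>b0 \<gamma> kR"
  by (simp add: velocity_bound_def)

text \<open>At angle 0 the first entry is the whole bound; otherwise the second grows like
  \<open>sqrt k\<close> up to a constant shift.\<close>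

lemma velocity_bound_at_top:
  assumes "0 < a" "\<epsilon> < 1"
  shows "filterlim (\<lambda>k. velocity_bound a \<epsilon> \<theta>0 \<theta>b0 \<gamma> k) at_top at_top"
proof -
  have lim: "filterlim (\<lambda>k. sqrt (c * k)) at_top at_top" if "0 < c" for c :: real
    by (intro filterlim_compose[OF sqrt_at_top] filterlim_tendsto_pos_mult_at_top[OF tendsto_const that]
        filterlim_ident)
  show ?thesis
  proof (cases "\<theta>0 = 0")
    case True
    then show ?thesis
      using lim[of "4 * a"] assms(1) by (simp add: velocity_bound_zero_angle)
  next
    case False
    have "filterlim (\<lambda>k. - (\<gamma> / 2 * \<theta>b0) + 2 * sqrt ((a * (1 - \<epsilon>)) * k)) at_top at_top"
      using assms by (intro filterlim_tendsto_add_at_top[OF tendsto_const]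
          filterlim_tendsto_pos_mult_at_top[OF tendsto_const] lim) auto
    then show ?thesis
      by (rule filterlim_at_top_mono)
        (use velocity_bound_ge[OF False, of a _ \<epsilon> \<gamma> \<theta>b0] in \<open>auto simp: mult_ac\<close>)
  qed
qed

lemma tracking_reference_of_trajectory:
  assumes "reference_trajectory Rd \<Omega>d"
  shows "tracking_reference Rd \<Omega>d"
  unfolding tracking_reference_def
proof (intro allI impI conjI)
  fix t :: real
  assume t: "0 \<le> t"
  show "rotation_matrix (Rd t)" "(Rd has_vector_derivative Rd t ** hat (\<Omega>d t)) (at t within {0..})"
    using assms t by (auto simp: reference_trajectory_def)
  obtain D where D: "\<And>t. 0 \<le> t \<Longrightarrow> D 0 t = \<Omega>d t"
      "\<And>n t. 0 \<le> t \<Longrightarrow> (D n has_vector_derivative D (Suc n) t) (at t within {0..})"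
    using assms unfolding reference_trajectory_def smooth_nonneg_def by blast
  have "D 0 differentiable (at t within {0..})"
    using D(2)[OF t] by (rule differentiableI_vector)
  then show "\<Omega>d differentiable (at t within {0..})"
    by (rule differentiable_transform_within[OF _ zero_less_one]) (use t D(1) in auto)
qed

text \<open>The shift splits the initial attitude error: the part of angle \<open>\<theta>0 - \<theta>b0\<close> seen by the shifted
  errors costs at most \<open>2 \<epsilon> a kR\<close> of energy, which leaves \<open>2 (1 - \<epsilon>) a kR\<close> for the velocity.\<close>

lemma shifted_initial_energy:
  assumes U0: "rotation_matrix U0" and Rd: "rotation_matrix (Rd 0)"
    and R0: "R0 = U0 ** Zrot \<theta>0 ** transpose U0 ** Rd 0"
    and shift: "0 \<le> \<theta>b0" "1 - cos (\<theta>0 - \<theta>b0) \<le> 2 * \<epsilon> * a" "0 \<le> \<gamma>"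
    and pos: "0 \<le> kR" "0 \<le> a" "\<epsilon> \<le> 1"
    and \<Omega>0: "norm (\<Omega>0 - \<Omega>d 0) \<le> 2 * sqrt (a * kR * (1 - \<epsilon>)) - \<gamma> / 2 * \<theta>b0"
  shows "V0 kR (shifted_R U0 \<theta>b0 \<gamma> Rd) (shifted_\<Omega> U0 \<theta>b0 \<gamma> Rd \<Omega>d) R0 \<Omega>0 0 \<le> 2 * a * kR"
proof -
  let ?\<Omega> = "shifted_\<Omega> U0 \<theta>b0 \<gamma> Rd \<Omega>d 0"
  have "kR / 4 * (norm (R0 - shifted_R U0 \<theta>b0 \<gamma> Rd 0))\<^sup>2 = kR * (1 - cos (\<theta>0 - \<theta>b0))"
    unfolding R0 shifted_R_def norm_conj_Zrot_diff[OF U0 Rd] by (simp add: shift_angle_def)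
  also have "\<dots> \<le> kR * (2 * \<epsilon> * a)"
    using shift(2) pos(1) by (rule mult_left_mono)
  finally have att: "kR / 4 * (norm (R0 - shifted_R U0 \<theta>b0 \<gamma> Rd 0))\<^sup>2 \<le> kR * (2 * \<epsilon> * a)" .
  have "norm (\<Omega>0 - ?\<Omega>) \<le> norm (\<Omega>0 - \<Omega>d 0) + norm (?\<Omega> - \<Omega>d 0)"
    using norm_triangle_ineq4[of "\<Omega>0 - \<Omega>d 0" "?\<Omega> - \<Omega>d 0"] by simp
  \<comment> \<open>At time 0 the shift contributes speed \<open>\<gamma> / 2 * \<theta>b0\<close>,
    exactly what the velocity bound subtracts.\<close>
  also have "\<dots> \<le> 2 * sqrt (a * kR * (1 - \<epsilon>))"
    using \<Omega>0 shifted_\<Omega>_dist[where Rd = Rd and t = 0, OF U0 Rd order_refl shift(1,3), of \<Omega>d] by simp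
  finally have "(norm (\<Omega>0 - ?\<Omega>))\<^sup>2 \<le> (2 * sqrt (a * kR * (1 - \<epsilon>)))\<^sup>2"
    by (rule power_mono) simp
  also have "\<dots> = 4 * (a * kR * (1 - \<epsilon>))"
    using pos by (simp add: power_mult_distrib)
  finally show ?thesis
    using att by (simp add: V0_def algebra_simps)
qed

text \<open>Passes from the shifted to the given reference at a rate no faster than either of the
  two.\<close>

lemma exponential_triangle:
  fixes x y z :: "'a::real_normed_vector" and \<alpha> \<beta> \<delta> :: real
  assumes xy: "norm (x - y) \<le> C * exp (- \<alpha> * t)" and yz: "norm (y - z) \<le> D * exp (- \<delta> * t)"
    and rates: "\<beta> \<le> \<alpha>" "\<beta> \<le> \<delta>" and "0 \<le> C" "0 \<le> D" "C + D \<le> B" "0 \<le> t"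
  shows "norm (x - z) \<le> B * exp (- \<beta> * t)"
proof -
  have "norm (x - z) \<le> norm (x - y) + norm (y - z)"
    using norm_triangle_ineq[of "x - y" "y - z"] by simp
  also have "\<dots> \<le> C * exp (- \<alpha> * t) + D * exp (- \<delta> * t)"
    using xy yz by (rule add_mono)
  also have "\<dots> \<le> C * exp (- \<beta> * t) + D * exp (- \<beta> * t)"
    using rates[THEN mult_right_mono, OF \<open>0 \<le> t\<close>] \<open>0 \<le> C\<close> \<open>0 \<le> D\<close>
    by (intro add_mono mult_left_mono) auto
  also have "\<dots> \<le> B * exp (- \<beta> * t)"
    using \<open>C + D \<le> B\<close> by (simp flip: distrib_right)
  finally show ?thesis .
qed

section \<open>Convergence in both control branches, coverage and growth\<close>

theorem mainTheorem9:
  fixes J :: "real^3^3"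
    and Rd :: "real \<Rightarrow> real^3^3" and \<Omega>d :: "real \<Rightarrow> real^3"
    and kR k\<Omega> a \<mu> \<epsilon> :: real
    and \<theta>b0 \<gamma> :: "real^3^3 \<Rightarrow> real"
  assumes inertia_sym: "transpose J = J"
    and inertia_pos: "\<And>x. x \<noteq> 0 \<Longrightarrow> 0 < x \<bullet> (J *v x)"
    and reference: "reference_trajectory Rd \<Omega>d"
    and gains: "0 < kR" "0 < k\<Omega>"
    and a: "0 < a" "a < 1"
    and eps: "0 < \<epsilon>" "\<epsilon> < 1"
    and mu: "0 < \<mu>" "\<mu> < 4 * (1 - a) * kR * k\<Omega> / (4 * (1 - a) * kR + k\<Omega>\<^sup>2)"
    and shift: "\<And>R0. \<lbrakk>rotation_matrix R0; 0 < initial_angle (Rd 0) R0\<rbrakk> \<Longrightarrow>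
        0 < \<theta>b0 R0 \<and> \<theta>b0 R0 < initial_angle (Rd 0) R0 \<and>
        1 - cos (initial_angle (Rd 0) R0 - \<theta>b0 R0) \<le> 2 * \<epsilon> * a \<and>
        0 < \<gamma> R0 \<and> \<gamma> R0 < 4 / \<theta>b0 R0 * sqrt (a * kR * (1 - \<epsilon>))"
  shows "(\<forall>R0 \<Omega>0 U0.
            (R0, \<Omega>0) \<in> attraction_set kR a \<epsilon> \<theta>b0 \<gamma> Rd \<Omega>d \<and>
            rotation_matrix U0 \<and>
            R0 = U0 ** Zrot (initial_angle (Rd 0) R0) ** transpose U0 ** Rd 0 \<longrightarrow>
            (\<exists>C>0. \<exists>\<alpha>>0. \<forall>T R \<Omega>.
               motion J (control J kR k\<Omega> a (\<theta>b0 R0) (\<gamma> R0) U0 Rd \<Omega>d R0 \<Omega>0) T R \<Omega> \<and>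
               R 0 = R0 \<and> \<Omega> 0 = \<Omega>0 \<longrightarrow>
               (\<forall>t. 0 \<le> t \<and> ereal t < T \<longrightarrow>
                  norm (R t - Rd t) \<le> C * exp (- \<alpha> * t) \<and>
                  norm (\<Omega> t - \<Omega>d t) \<le> C * exp (- \<alpha> * t))))
       \<and> (\<forall>R0. rotation_matrix R0 \<longrightarrow>
            (\<exists>\<Omega>0. (R0, \<Omega>0) \<in> attraction_set kR a \<epsilon> \<theta>b0 \<gamma> Rd \<Omega>d))
       \<and> (\<forall>R0. rotation_matrix R0 \<longrightarrow>
            filterlim (\<lambda>k. velocity_bound a \<epsilon> (initial_angle (Rd 0) R0) (\<theta>b0 R0) (\<gamma> R0) k)
              at_top at_top)"
proof (intro conjI allI impI)
  have ref: "tracking_reference Rd \<Omega>d"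
    by (rule tracking_reference_of_trajectory[OF reference])
  then have Rd: "rotation_matrix (Rd t)" if "0 \<le> t" for t
    using that by (simp add: tracking_reference_def)
  {
    fix R0 \<Omega>0 U0
    assume "(R0, \<Omega>0) \<in> attraction_set kR a \<epsilon> \<theta>b0 \<gamma> Rd \<Omega>d \<and> rotation_matrix U0 \<and>
      R0 = U0 ** Zrot (initial_angle (Rd 0) R0) ** transpose U0 ** Rd 0"
    then have U0: "rotation_matrix U0" and rotR0: "rotation_matrix R0"
      and R0: "R0 = U0 ** Zrot (initial_angle (Rd 0) R0) ** transpose U0 ** Rd 0"
      and \<Omega>0: "norm (\<Omega>0 - \<Omega>d 0) < velocity_bound a \<epsilon> (initial_angle (Rd 0) R0) (\<theta>b0 R0) (\<gamma> R0) kR"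
      by (auto simp: attraction_set_def)
    let ?\<theta>0 = "initial_angle (Rd 0) R0" and ?\<theta>b = "\<theta>b0 R0" and ?\<gamma> = "\<gamma> R0"
    let ?ctrl = "control J kR k\<Omega> a ?\<theta>b ?\<gamma> U0 Rd \<Omega>d R0 \<Omega>0"
    let ?S = "shifted_R U0 ?\<theta>b ?\<gamma> Rd" and ?\<Omega>s = "shifted_\<Omega> U0 ?\<theta>b ?\<gamma> Rd \<Omega>d"
    show "\<exists>C>0. \<exists>\<alpha>>0. \<forall>T R \<Omega>. motion J ?ctrl T R \<Omega> \<and> R 0 = R0 \<and> \<Omega> 0 = \<Omega>0 \<longrightarrow>
               (\<forall>t. 0 \<le> t \<and> ereal t < T \<longrightarrow>
                  norm (R t - Rd t) \<le> C * exp (- \<alpha> * t) \<and>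
                  norm (\<Omega> t - \<Omega>d t) \<le> C * exp (- \<alpha> * t))"
    proof (cases "V0 kR Rd \<Omega>d R0 \<Omega>0 0 \<le> 2 * a * kR")
      case True
      then have "?ctrl = track_torque J kR k\<Omega> Rd \<Omega>d"
        by (simp add: control_def fun_eq_iff)
      with True exponential_tracking[OF inertia_pos ref gains a] show ?thesis
        by metis
    next
      case False
      then have ctrl: "?ctrl = track_torque J kR k\<Omega> ?S ?\<Omega>s"
        by (simp add: control_def fun_eq_iff)
      \<comment> \<open>The first entry of the maximum would put the state in the unshifted branch:
        \<open>kR * (1 - cos ?\<theta>0)\<close> and half the squared velocity bound add up to
        \<open>2 * a * kR\<close>.\<close>
      have not_first: "\<not> norm (\<Omega>0 - \<Omega>d 0) < sqrt (2 * kR * (2 * a - 1 + cos ?\<theta>0))"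
        if "0 \<le> 2 * a - 1 + cos ?\<theta>0"
      proof
        assume "norm (\<Omega>0 - \<Omega>d 0) < sqrt (2 * kR * (2 * a - 1 + cos ?\<theta>0))"
        then have "(norm (\<Omega>0 - \<Omega>d 0))\<^sup>2 \<le> (sqrt (2 * kR * (2 * a - 1 + cos ?\<theta>0)))\<^sup>2"
          by (intro power_mono) auto
        also have "\<dots> = 2 * kR * (2 * a - 1 + cos ?\<theta>0)"
          using gains that by simp
        finally have "(norm (\<Omega>0 - \<Omega>d 0))\<^sup>2 \<le> 2 * kR * (2 * a - 1 + cos ?\<theta>0)" .
        moreover have att: "(norm (R0 - Rd 0))\<^sup>2 = 4 * (1 - cos ?\<theta>0)"
          using norm_conj_Zrot_diff_base[OF U0 Rd[OF order_refl], of ?\<theta>0] R0 by simp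
        ultimately have "V0 kR Rd \<Omega>d R0 \<Omega>0 0 \<le> 2 * a * kR"
          unfolding V0_def att by (simp add: algebra_simps)
        with False show False ..
      qed
      have \<Omega>0': "norm (\<Omega>0 - \<Omega>d 0) < 2 * sqrt (a * kR * (1 - \<epsilon>)) - ?\<gamma> / 2 * ?\<theta>b" and "?\<theta>0 \<noteq> 0"
        using velocity_bound_cases[OF \<Omega>0] not_first a(1) by auto
      then have "0 < ?\<theta>0"
        using initial_angle_nonneg[OF Rd[OF order_refl] rotR0] by linarith
      from shift[OF rotR0 this] have sh: "0 < ?\<theta>b" "1 - cos (?\<theta>0 - ?\<theta>b) \<le> 2 * \<epsilon> * a" "0 < ?\<gamma>"
        by auto
      have init: "V0 kR ?S ?\<Omega>s R0 \<Omega>0 0 \<le> 2 * a * kR"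
        using sh gains a eps \<Omega>0' by (intro shifted_initial_energy[where Rd = Rd, OF U0 Rd[OF order_refl] R0]) auto
      obtain C \<alpha> where C: "0 < C" "0 < \<alpha>" and track: "\<And>T R \<Omega> t.
          motion J ?ctrl T R \<Omega> \<Longrightarrow> R 0 = R0 \<Longrightarrow> \<Omega> 0 = \<Omega>0 \<Longrightarrow> 0 \<le> t \<Longrightarrow> ereal t < T \<Longrightarrow>
          norm (R t - ?S t) \<le> C * exp (- \<alpha> * t) \<and> norm (\<Omega> t - ?\<Omega>s t) \<le> C * exp (- \<alpha> * t)"
        using exponential_tracking[OF inertia_pos tracking_reference_shifted[OF ref U0] gains a] init
        unfolding ctrl by metis
      \<comment> \<open>The slower of the tracking rate and the rate at which the shift dies
        out.\<close>
      define \<beta> where "\<beta> = min \<alpha> (?\<gamma> / 2)"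
      define B where "B = C + 2 * ?\<theta>b + ?\<gamma> / 2 * ?\<theta>b"
      have "norm (R t - Rd t) \<le> B * exp (- \<beta> * t) \<and> norm (\<Omega> t - \<Omega>d t) \<le> B * exp (- \<beta> * t)"
        if "motion J ?ctrl T R \<Omega>" "R 0 = R0" "\<Omega> 0 = \<Omega>0" "0 \<le> t" "ereal t < T" for T R \<Omega> t
      proof -
        have rates: "\<beta> \<le> \<alpha>" "\<beta> \<le> ?\<gamma> / 2"
          by (simp_all add: \<beta>_def)
        have "norm (?S t - Rd t) \<le> 2 * ?\<theta>b * exp (- (?\<gamma> / 2) * t)"
          using shifted_R_close[where Rd = Rd and t = t, OF U0 Rd[OF that(4)]] sh(1) by simp
        moreover have "norm (?\<Omega>s t - \<Omega>d t) \<le> ?\<gamma> / 2 * ?\<theta>b * exp (- (?\<gamma> / 2) * t)"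
          using shifted_\<Omega>_dist[where Rd = Rd and t = t, OF U0 Rd[OF that(4)] that(4)] sh(1,3) by simp
        moreover have "0 \<le> ?\<gamma> / 2 * ?\<theta>b"
          using sh by simp
        ultimately show ?thesis
          using track[OF that] sh C(1) that(4)
          by (intro conjI exponential_triangle[OF _ _ rates, of _ "?S t" C t _ "2 * ?\<theta>b"]
              exponential_triangle[OF _ _ rates, of _ "?\<Omega>s t" C t _ "?\<gamma> / 2 * ?\<theta>b"])
            (simp_all add: B_def)
      qed
      moreover have "0 < B" "0 < \<beta>"
        using C sh by (auto simp: B_def \<beta>_def intro!: add_pos_pos)
      ultimately show ?thesis
        by (intro exI[of _ B] conjI exI[of _ \<beta>]) auto
    qed
  }
  {
    fix R0 :: "real^3^3"
    assume R0: "rotation_matrix R0"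
    let ?\<theta>0 = "initial_angle (Rd 0) R0"
    have "0 < velocity_bound a \<epsilon> ?\<theta>0 (\<theta>b0 R0) (\<gamma> R0) kR"
    proof (cases "?\<theta>0 = 0")
      case True
      then show ?thesis
        using a gains by (simp add: velocity_bound_zero_angle)
    next
      case False
      then have "0 < ?\<theta>0"
        using initial_angle_nonneg[OF Rd[OF order_refl] R0] by linarith
      \<comment> \<open>The upper bound on \<gamma> is precisely positivity of the second
        entry.\<close>
      from shift[OF R0 this] have "0 < 2 * sqrt (a * kR * (1 - \<epsilon>)) - \<gamma> R0 / 2 * \<theta>b0 R0"
        by (auto simp: field_simps)
      also have "\<dots> \<le> velocity_bound a \<epsilon> ?\<theta>0 (\<theta>b0 R0) (\<gamma> R0) kR"
        by (rule velocity_bound_ge[OF False])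
      finally show ?thesis .
    qed
    then show "\<exists>\<Omega>0. (R0, \<Omega>0) \<in> attraction_set kR a \<epsilon> \<theta>b0 \<gamma> Rd \<Omega>d"
      \<comment> \<open>The witness has zero initial velocity error, so a positive bound
        suffices.\<close>
      using R0 by (intro exI[of _ "\<Omega>d 0"]) (simp add: attraction_set_def)
    show "filterlim (\<lambda>k. velocity_bound a \<epsilon> ?\<theta>0 (\<theta>b0 R0) (\<gamma> R0) k) at_top at_top"
      using velocity_bound_at_top[OF a(1) eps(2)] .
  }
qed

end
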